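(* If the graphon $W$ is piecewise Lipschitz, then the modified neighborhood smoothing estimator $\hat P$ is a consistent estimator of the edge probability matrix $P$ in max-norm: for every $\epsilon>0$, $\lim_{n\to\infty}\Pr\big(\max_{i\ne j}|P_{ij}-\hat P_{ij}|>\epsilon\big)=0$.
   Context: A graphon is a symmetric measurable $W:[0,1]^2\to[0,1]$. $W$ is piecewise Lipschitz if for some $c\ge 0$ there is a finite partition $\{B_1,\dots,B_k\}$ of $[0,1]$ into disjoint (open, half-open or closed) intervals of positive length such that $|W(x,y)-W(x',y')|\le c(|x-x'|+|y-y'|)$ for all $(x,y),(x',y')\in B_i\times B_j$ and all $i,j$. Sampling: draw $x_1,\dots,x_n$ i.i.d. uniform on $[0,1]$, put $P_{ij}=W(x_i,x_j)$ (the random edge probability matrix), and given the $x_i$ let $A$ be the symmetric $0/1$ adjacency matrix with zero diagonal whose entries $A_{ij}$, $i<j$, are independent Bernoulli($P_{ij}$). $\Pr$ refers to this joint law. Modified neighborhood smoothing (computed from $A$ only), with a fixed constant $C\in(0,1)$: set $h=C\sqrt{(\log n)/n}$. For each $j$ let $\partial_jA$ be $A$ with row and column $j$ set to zero, and for distinct $i,i',j$ put $$d_j(i,i')=\max_{k\ne i,i',j}\Big|\big((\partial_jA)^2/n\big)_{ik}-\big((\partial_jA)^2/n\big)_{i'k}\Big|.$$ For $i\neq j$ let $q_{i\setminus j}(h)$ be the $h$-th quantile of $\{d_j(i,i'):i'\ne i,j\}$ (the smallest $q$ such that at least a fraction $h$ of these values are $\le q$), $\mathcal N_{i\setminus j}=\{i'\ne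 i,j: d_j(i,i')\le q_{i\setminus j}(h)\}$, and $$\hat P_{ij}=\frac12\Big(\frac1{|\mathcal N_{i\setminus j}|}\sum_{i'\in\mathcal N_{i\setminus j}}A_{i'j}+\frac1{|\mathcal N_{j\setminus i}|}\sum_{j'\in\mathcal N_{j\setminus i}}A_{ij'}\Big).$$ *)

theory Defs
  imports "HOL-Probability.Probability"
begin

section \<open>Graphons\<close>

text \<open>
  A graphon is a function on \<open>[0,1]\<^sup>2\<close>; the values of \<open>W\<close> outside the unit square are
  unconstrained and play no role anywhere below.
\<close>

definition graphon :: "(real \<Rightarrow> real \<Rightarrow> real) \<Rightarrow> bool" where
  "graphon W \<longleftrightarrow>
     (\<lambda>(x, y). W x y) \<in> borel_measurable (restrict_space borel ({0..1} \<times> {0..1})) \<and>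
     (\<forall>x\<in>{0..1}. \<forall>y\<in>{0..1}. W x y = W y x \<and> W x y \<in> {0..1})"

definition piecewise_lipschitz :: "(real \<Rightarrow> real \<Rightarrow> real) \<Rightarrow> bool" where
  "piecewise_lipschitz W \<longleftrightarrow>
     (\<exists>c\<ge>0. \<exists>\<B>. finite \<B> \<and> partition_on {0..1} \<B> \<and>
        (\<forall>B\<in>\<B>. is_interval B \<and> 0 < measure lborel B) \<and>
        (\<forall>B\<in>\<B>. \<forall>B'\<in>\<B>. \<forall>x\<in>B. \<forall>x'\<in>B. \<forall>y\<in>B'. \<forall>y'\<in>B'.
           \<bar>W x y - W x' y'\<bar> \<le> c * (\<bar>x - x'\<bar> + \<bar>y - y'\<bar>)))"


section \<open>The sampling model\<close>

text \<open>
  An \<open>n \<times> n\<close> matrix is a function \<^typ>\<open>nat \<Rightarrow> nat \<Rightarrow> real\<close> of which only the entries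
  with indices in \<open>{..<n}\<close> matter; vertices are numbered from \<open>0\<close> to \<open>n - 1\<close>.
\<close>

text \<open>
  Lebesgue measure restricted to \<open>[0,1]\<close> is the uniform distribution on \<open>[0,1]\<close>. Unlike
  \<^term>\<open>uniform_measure lborel {0..1::real}\<close>, its space is \<open>[0,1]\<close> rather than the real line.
\<close>

definition latent_law :: "nat \<Rightarrow> (nat \<Rightarrow> real) measure" where
  "latent_law n = PiM {..<n} (\<lambda>_. restrict_space lborel {0..1})"

definition edge_prob :: "(real \<Rightarrow> real \<Rightarrow> real) \<Rightarrow> (nat \<Rightarrow> real) \<Rightarrow> nat \<Rightarrow> nat \<Rightarrow> real" where
  "edge_prob W x i j = W (x i) (x j)"

definition vertex_pairs :: "nat \<Rightarrow> (nat \<times> nat) set" where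
  "vertex_pairs n = {(i, j). i < j \<and> j < n}"

text \<open>The symmetric matrix with zero diagonal whose entries above the diagonal are given by \<open>e\<close>.\<close>

definition adjacency_matrix :: "(nat \<times> nat \<Rightarrow> bool) \<Rightarrow> nat \<Rightarrow> nat \<Rightarrow> real" where
  "adjacency_matrix e i j = (if i = j then 0 else of_bool (e (min i j, max i j)))"

definition adjacency_pmf :: "nat \<Rightarrow> (nat \<Rightarrow> nat \<Rightarrow> real) \<Rightarrow> (nat \<Rightarrow> nat \<Rightarrow> real) pmf" where
  "adjacency_pmf n P =
     map_pmf adjacency_matrix
       (Pi_pmf (vertex_pairs n) False (\<lambda>(i, j). bernoulli_pmf (P i j)))"

text \<open>
  The joint law of \<open>(x, A)\<close>: first \<open>x\<close> is drawn, then \<open>A\<close> from its conditional law given \<open>x\<close>.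
\<close>

definition sample_law ::
    "(real \<Rightarrow> real \<Rightarrow> real) \<Rightarrow> nat \<Rightarrow> ((nat \<Rightarrow> real) \<times> (nat \<Rightarrow> nat \<Rightarrow> real)) measure" where
  "sample_law W n =
     latent_law n \<bind> (\<lambda>x.
       distr (measure_pmf (adjacency_pmf n (edge_prob W x)))
         (latent_law n \<Otimes>\<^sub>M count_space UNIV) (\<lambda>A. (x, A)))"


section \<open>Modified neighborhood smoothing\<close>

definition delete_vertex :: "nat \<Rightarrow> (nat \<Rightarrow> nat \<Rightarrow> real) \<Rightarrow> nat \<Rightarrow> nat \<Rightarrow> real" where
  "delete_vertex j A i k = (if i = j \<or> k = j then 0 else A i k)"

definition mat_square :: "nat \<Rightarrow> (nat \<Rightarrow> nat \<Rightarrow> real) \<Rightarrow> nat \<Rightarrow> nat \<Rightarrow> real" where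
  "mat_square n M i k = (\<Sum>l<n. M i l * M l k)"

text \<open>
  For \<open>n \<le> 3\<close> the maximum below is over the empty set and has an unspecified value.
\<close>

definition nbr_dist :: "nat \<Rightarrow> (nat \<Rightarrow> nat \<Rightarrow> real) \<Rightarrow> nat \<Rightarrow> nat \<Rightarrow> nat \<Rightarrow> real" where
  "nbr_dist n A j i i' =
     Max ((\<lambda>k. \<bar>mat_square n (delete_vertex j A) i k / real n -
                mat_square n (delete_vertex j A) i' k / real n\<bar>) ` ({..<n} - {i, i', j}))"

text \<open>
  The \<open>h\<close>-th quantile of the family of values \<open>(f i)\<^sub>i\<^sub>\<in>\<^sub>I\<close>, counted with multiplicity.
\<close>

definition quantile :: "real \<Rightarrow> ('i \<Rightarrow> real) \<Rightarrow> 'i set \<Rightarrow> real" where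
  "quantile h f I = (LEAST q. real (card {i \<in> I. f i \<le> q}) \<ge> h * real (card I))"

definition bandwidth :: "real \<Rightarrow> nat \<Rightarrow> real" where
  "bandwidth C n = C * sqrt (ln (real n) / real n)"

text \<open>\<open>nbhd C n A i j\<close> is the neighborhood of \<open>i\<close> computed without using vertex \<open>j\<close>.\<close>

definition nbhd :: "real \<Rightarrow> nat \<Rightarrow> (nat \<Rightarrow> nat \<Rightarrow> real) \<Rightarrow> nat \<Rightarrow> nat \<Rightarrow> nat set" where
  "nbhd C n A i j =
     {i' \<in> {..<n} - {i, j}.
        nbr_dist n A j i i' \<le> quantile (bandwidth C n) (nbr_dist n A j i) ({..<n} - {i, j})}"

definition smoothing_estimator ::
    "real \<Rightarrow> nat \<Rightarrow> (nat \<Rightarrow> nat \<Rightarrow> real) \<Rightarrow> nat \<Rightarrow> nat \<Rightarrow> real" where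
  "smoothing_estimator C n A i j =
     1 / 2 * (1 / real (card (nbhd C n A i j)) * (\<Sum>i'\<in>nbhd C n A i j. A i' j) +
              1 / real (card (nbhd C n A j i)) * (\<Sum>j'\<in>nbhd C n A j i. A i j'))"

definition offdiag_max_dist ::
    "nat \<Rightarrow> (nat \<Rightarrow> nat \<Rightarrow> real) \<Rightarrow> (nat \<Rightarrow> nat \<Rightarrow> real) \<Rightarrow> real" where
  "offdiag_max_dist n P Q =
     Max {\<bar>P i j - Q i j\<bar> | i j. i < n \<and> j < n \<and> i \<noteq> j}"


section \<open>Well-definedness of the sampling model\<close>

lemma prob_space_unit_interval: "prob_space (restrict_space lborel {0..1::real})"
  by (rule prob_space_restrict_space) auto

lemma prob_space_latent_law: "prob_space (latent_law n)"
  unfolding latent_law_def by (intro prob_space_PiM prob_space_unit_interval)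

lemma finite_vertex_pairs: "finite (vertex_pairs n)"
  by (rule finite_subset[of _ "{..<n} \<times> {..<n}"]) (auto simp: vertex_pairs_def)

lemma edge_prob_measurable:
  assumes "graphon W" "i < n" "j < n"
  shows "(\<lambda>x. edge_prob W x i j) \<in> borel_measurable (latent_law n)"
proof -
  have comp: "(\<lambda>x. x k) \<in> latent_law n \<rightarrow>\<^sub>M restrict_space lborel {0..1}" if "k < n" for k
    unfolding latent_law_def using that by (intro measurable_component_singleton) auto
  have borel: "(\<lambda>x. x k) \<in> borel_measurable (latent_law n)" if "k < n" for k
    using comp[OF that] by (simp add: measurable_restrict_space2_iff cong: measurable_cong_sets)
  have range: "x k \<in> {0..1}" if "k < n" "x \<in> space (latent_law n)" for x k
    using measurable_space[OF comp that(2)] that(1) by (simp add: space_restrict_space)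
  have "(\<lambda>x. (x i, x j)) \<in> latent_law n \<rightarrow>\<^sub>M restrict_space borel ({0..1} \<times> {0..1})"
    using assms borel range by (intro measurable_restrict_space2 borel_measurable_Pair) auto
  from measurable_compose[OF this, of "\<lambda>(x, y). W x y" borel] assms(1)
  show ?thesis by (simp add: graphon_def edge_prob_def)
qed

lemma adjacency_kernel_measurable:
  assumes "graphon W"
  shows "(\<lambda>x. distr (measure_pmf (adjacency_pmf n (edge_prob W x)))
            (latent_law n \<Otimes>\<^sub>M count_space UNIV) (\<lambda>A. (x, A)))
         \<in> latent_law n \<rightarrow>\<^sub>M prob_algebra (latent_law n \<Otimes>\<^sub>M count_space UNIV)"
    (is "?K \<in> _ \<rightarrow>\<^sub>M prob_algebra ?N")
proof -
  have pair: "(\<lambda>A. (x, A)) \<in> measure_pmf p \<rightarrow>\<^sub>M ?N" if "x \<in> space (latent_law n)"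
    for x and p :: "(nat \<Rightarrow> nat \<Rightarrow> real) pmf"
    using that by (auto simp: space_pair_measure)
  define F where "F = {e::nat \<times> nat \<Rightarrow> bool. \<forall>z. z \<notin> vertex_pairs n \<longrightarrow> \<not> e z}"
  have finF: "finite F"
  proof (rule finite_subset)
    show "F \<subseteq> (\<lambda>S z. z \<in> S) ` Pow (vertex_pairs n)"
    proof
      fix e assume "e \<in> F"
      then have "e = (\<lambda>z. z \<in> Collect e)" "Collect e \<in> Pow (vertex_pairs n)"
        by (auto simp: F_def)
      then show "e \<in> (\<lambda>S z. z \<in> S) ` Pow (vertex_pairs n)" by blast
    qed
  qed (simp add: finite_vertex_pairs)
  have "?K \<in> latent_law n \<rightarrow>\<^sub>M subprob_algebra ?N"
  proof (rule measurable_subprob_algebra)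
    fix x assume "x \<in> space (latent_law n)"
    then show "subprob_space (?K x)"
      by (intro prob_space_imp_subprob_space measure_pmf.prob_space_distr pair)
  next
    fix S assume S: "S \<in> sets ?N"
    have eq: "emeasure (?K x) S =
        (\<Sum>e\<in>F. indicator S (x, adjacency_matrix e) *
           ennreal (\<Prod>(i, j)\<in>vertex_pairs n. pmf (bernoulli_pmf (edge_prob W x i j)) (e (i, j))))"
      if x: "x \<in> space (latent_law n)" for x
    proof -
      let ?p = "Pi_pmf (vertex_pairs n) False (\<lambda>(i, j). bernoulli_pmf (edge_prob W x i j))"
      have supp: "set_pmf ?p \<subseteq> F"
        using finite_vertex_pairs set_Pi_pmf_subset[of "vertex_pairs n" False] by (fastforce simp: F_def)
      have "emeasure (?K x) S = (\<integral>\<^sup>+z. indicator S z \<partial>?K x)"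
        using S by simp
      also have "\<dots> = (\<integral>\<^sup>+e. indicator S (x, adjacency_matrix e) \<partial>measure_pmf ?p)"
        unfolding adjacency_pmf_def using x S
        by (subst nn_integral_distr) (auto simp: nn_integral_map_pmf space_pair_measure)
      also have "\<dots> = (\<Sum>e\<in>F. indicator S (x, adjacency_matrix e) * ennreal (pmf ?p e))"
        using supp finF by (intro nn_integral_measure_pmf_support) (auto simp: set_pmf_iff)
      also have "\<dots> = (\<Sum>e\<in>F. indicator S (x, adjacency_matrix e) *
           ennreal (\<Prod>(i, j)\<in>vertex_pairs n. pmf (bernoulli_pmf (edge_prob W x i j)) (e (i, j))))"
        by (intro sum.cong refl arg_cong2[where f = times] arg_cong[where f = ennreal])
           (auto simp: F_def pmf_Pi[OF finite_vertex_pairs] intro!: prod.cong)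
      finally show ?thesis .
    qed
    have pmf_eq: "pmf (bernoulli_pmf (edge_prob W x i j)) b =
        (if b then edge_prob W x i j else 1 - edge_prob W x i j)"
      if "x \<in> space (latent_law n)" "i < n" "j < n" for x i j b
    proof -
      have "x k \<in> {0..1}" if "k < n" for k
        using \<open>x \<in> space (latent_law n)\<close> that
        by (auto simp: latent_law_def space_PiM space_restrict_space PiE_def Pi_def)
      then show ?thesis
        using assms that by (cases b) (auto simp: graphon_def edge_prob_def)
    qed
    have meas: "(\<lambda>x. pmf (bernoulli_pmf (edge_prob W x i j)) b) \<in> borel_measurable (latent_law n)"
      if "i < n" "j < n" for i j b
      using edge_prob_measurable[OF assms that] that
      by (subst measurable_cong[OF pmf_eq]) auto
    have ind: "(\<lambda>x. indicator S (x, a) :: ennreal) \<in> borel_measurable (latent_law n)" for a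
      using S by (intro borel_measurable_indicator'[unfolded comp_def]) auto
    show "(\<lambda>x. emeasure (?K x) S) \<in> borel_measurable (latent_law n)"
      by (subst measurable_cong[OF eq], assumption)
         (auto intro!: borel_measurable_sum borel_measurable_times_ennreal ind
            measurable_compose[OF _ measurable_ennreal] borel_measurable_prod meas
            simp: vertex_pairs_def split_beta)
  qed simp
  then show ?thesis
    by (rule measurable_prob_algebraI[rotated]) (intro measure_pmf.prob_space_distr pair)
qed

lemma
  assumes "graphon W"
  shows prob_space_sample_law: "prob_space (sample_law W n)"
    and sets_sample_law: "sets (sample_law W n) = sets (latent_law n \<Otimes>\<^sub>M count_space UNIV)"
proof -
  have "latent_law n \<in> space (prob_algebra (latent_law n))"
    by (simp add: space_prob_algebra prob_space_latent_law)
  from prob_space_bind'[OF this adjacency_kernel_measurable[OF assms]]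
    sets_bind'[OF this adjacency_kernel_measurable[OF assms]]
  show "prob_space (sample_law W n)"
    and "sets (sample_law W n) = sets (latent_law n \<Otimes>\<^sub>M count_space UNIV)"
    by (simp_all add: sample_law_def)
qed

lemma deviation_event_measurable:
  assumes "graphon W"
  shows "{(x, A) \<in> space (sample_law W n).
            offdiag_max_dist n (edge_prob W x) (smoothing_estimator C n A) > \<epsilon>}
         \<in> sets (sample_law W n)"
proof -
  let ?M = "latent_law n \<Otimes>\<^sub>M (count_space UNIV :: (nat \<Rightarrow> nat \<Rightarrow> real) measure)"
  define D where "D = {(i, j). i < n \<and> j < n \<and> i \<noteq> j}"
  have finD: "finite D"
    by (rule finite_subset[of _ "{..<n} \<times> {..<n}"]) (auto simp: D_def)
  define g where "g = (\<lambda>(i, j) (x, A). \<bar>edge_prob W x i j - smoothing_estimator C n A i j\<bar>)"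
  have g_meas: "g d \<in> borel_measurable ?M" if "d \<in> D" for d
  proof -
    obtain i j where d: "d = (i, j)" by fastforce
    with that have ij: "i < n" "j < n" by (auto simp: D_def)
    have "(\<lambda>\<omega>. edge_prob W (fst \<omega>) i j) \<in> borel_measurable ?M"
      by (rule measurable_compose[OF measurable_fst edge_prob_measurable[OF assms ij]])
    moreover have "(\<lambda>\<omega>. smoothing_estimator C n (snd \<omega>) i j) \<in> borel_measurable ?M"
      by (rule measurable_compose[OF measurable_snd]) simp
    ultimately show ?thesis
      by (simp add: d g_def split_beta)
  qed
  have eq: "offdiag_max_dist n (edge_prob W x) (smoothing_estimator C n A) =
      Max ((\<lambda>d. g d (x, A)) ` D)" for x A
    unfolding offdiag_max_dist_def by (rule arg_cong[where f = Max]) (force simp: D_def g_def)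
  have sp: "space (sample_law W n) = space ?M"
    by (rule sets_eq_imp_space_eq[OF sets_sample_law[OF assms]])
  show ?thesis
  proof (cases "D = {}")
    case True
    then show ?thesis
      using sets.top[of "sample_law W n"] by (cases "Max ({}::real set) > \<epsilon>") (simp_all add: eq)
  next
    case False
    then have "{(x, A) \<in> space (sample_law W n).
        offdiag_max_dist n (edge_prob W x) (smoothing_estimator C n A) > \<epsilon>} =
        (\<Union>d\<in>D. {\<omega> \<in> space ?M. \<epsilon> < g d \<omega>})"
      using finD by (auto simp: eq sp Max_gr_iff)
    also have "\<dots> \<in> sets ?M"
      using finD g_meas by (intro sets.finite_UN borel_measurable_less) auto
    finally show ?thesis
      by (simp add: sets_sample_law[OF assms])
  qed
qed

end

theory Submission
  imports Defs "HOL-Real_Asymp.Real_Asymp"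
begin

text \<open>
  Vertices are compared through the codegrees \<open>p(i,k) = (1/n) \<Sum>\<^sub>l P\<^sub>i\<^sub>l P\<^sub>l\<^sub>k\<close>, which the entries of
  \<open>A\<^sup>2/n\<close> approximate. Conditionally on \<open>x\<close>, everything random is a weighted sum
  \<open>\<Sum>\<^sub>l a\<^sub>l (A\<^sub>l\<^sub>j - P\<^sub>l\<^sub>j)\<close> over the edges at one vertex \<open>j\<close> whose weights depend only on the
  other edges, so Hoeffding's inequality and a union bound control it; for the neighborhood average
  the weights are \<open>1/|N|\<close> on the neighborhood, which is where deleting vertex \<open>j\<close> is needed.
  Since \<open>[0,1]\<close> is covered by finitely many cells of positive length on which \<open>W\<close> hardly varies,
  each vertex has linearly many near-twins. As the bandwidth tends to 0, the quantile is therefore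
  small, so the neighbors \<open>i'\<close> of \<open>i\<close> have almost the same codegrees as \<open>i\<close>. This makes the rows
  \<open>P\<^sub>i\<close> and \<open>P\<^sub>i\<^sub>'\<close> close in mean square, and the near-twins of \<open>j\<close> upgrade this to closeness
  of \<open>P\<^sub>i\<^sub>j\<close> and \<open>P\<^sub>i\<^sub>'\<^sub>j\<close>.
\<close>

section \<open>Concentration of weighted stars\<close>

text \<open>Each summand \<open>c z * of_bool (f z)\<close> stays between 0 and \<open>c z\<close>,
  so Hoeffding's inequality has the sum of squared weights in the exponent. Allowing any positive
  upper bound \<open>v\<close> also covers weights that all vanish, where the event is
  empty.\<close>

lemma Hoeffding_Pi_pmf_bernoulli:
  fixes c p :: "'a \<Rightarrow> real"
  assumes fin: "finite Z" and p: "\<And>z. z \<in> Z \<Longrightarrow> p z \<in> {0..1}"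
    and v: "(\<Sum>z\<in>Z. (c z)\<^sup>2) \<le> v" "0 < v" and s: "0 < s"
  shows "measure (Pi_pmf Z False (\<lambda>z. bernoulli_pmf (p z)))
      {f. \<bar>\<Sum>z\<in>Z. c z * (of_bool (f z) - p z)\<bar> \<ge> s} \<le> 2 * exp (- 2 * s\<^sup>2 / v)"
proof (cases "(\<Sum>z\<in>Z. (c z)\<^sup>2) > 0")
  case True
  let ?M = "Pi_pmf Z False (\<lambda>z. bernoulli_pmf (p z))"
  have E: "measure_pmf.expectation ?M (\<lambda>f. c z * of_bool (f z)) = c z * p z" if "z \<in> Z" for z
  proof -
    have "measure_pmf.expectation ?M (\<lambda>f. c z * of_bool (f z)) =
        measure_pmf.expectation (map_pmf (\<lambda>f. f z) ?M) (\<lambda>b. c z * of_bool b)"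
      by simp
    also have "\<dots> = c z * p z"
      using p[OF that] that fin by (subst Pi_pmf_component) auto
    finally show ?thesis .
  qed
  interpret Hoeffding_ineq ?M Z "\<lambda>z f. c z * of_bool (f z)" "\<lambda>z. min 0 (c z)" "\<lambda>z. max 0 (c z)"
    "\<Sum>z\<in>Z. c z * p z"
  proof unfold_locales
    show "prob_space.indep_vars ?M (\<lambda>_. borel) (\<lambda>z f. c z * of_bool (f z)) Z"
      using fin by (intro prob_space.indep_vars_compose2[OF _ indep_vars_Pi_pmf])
        (auto simp: measure_pmf.prob_space_axioms)
    show "(\<Sum>z\<in>Z. c z * p z) \<equiv> (\<Sum>z\<in>Z. measure_pmf.expectation ?M (\<lambda>f. c z * of_bool (f z)))"
      by (intro eq_reflection sum.cong refl E[symmetric])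
  qed (use fin in \<open>auto split: split_of_bool\<close>)
  have sq: "(max 0 (c z) - min 0 (c z))\<^sup>2 = (c z)\<^sup>2" for z
    by (auto simp: max_def min_def)
  have "measure ?M {f. \<bar>\<Sum>z\<in>Z. c z * (of_bool (f z) - p z)\<bar> \<ge> s} \<le>
      2 * exp (- 2 * s\<^sup>2 / (\<Sum>z\<in>Z. (c z)\<^sup>2))"
    using Hoeffding_ineq_abs_ge[of s] True s
    by (simp add: sq right_diff_distrib sum_subtractf)
  also have "\<dots> \<le> 2 * exp (- 2 * s\<^sup>2 / v)"
    using True v by (simp add: frac_le)
  finally show ?thesis .
next
  case False
  then have "(\<Sum>z\<in>Z. (c z)\<^sup>2) = 0"
    by (meson not_less order_antisym sum_nonneg zero_le_power2)
  then have "\<forall>z\<in>Z. c z = 0"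
    using fin by (simp add: sum_nonneg_eq_0_iff)
  then have "{f. \<bar>\<Sum>z\<in>Z. c z * (of_bool (f z) - p z)\<bar> \<ge> s} = {}"
    using s by auto
  then show ?thesis by simp
qed

text \<open>Conditioning on the second component: a bound on every slice over its support survives
  averaging.\<close>

lemma measure_pair_pmf_le:
  fixes p :: "'a pmf" and q :: "'b pmf"
  assumes "\<And>y. y \<in> set_pmf q \<Longrightarrow> measure p {x. (x, y) \<in> S} \<le> b"
  shows "measure_pmf.prob (pair_pmf p q) S \<le> b"
proof -
  obtain y0 where "y0 \<in> set_pmf q" using set_pmf_not_empty by fast
  from assms[OF this] have b: "0 \<le> b" using measure_nonneg order_trans by blast
  have "pair_pmf p q = q \<bind> (\<lambda>y. map_pmf (\<lambda>x. (x, y)) p)"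
    unfolding pair_pmf_def map_pmf_def by (rule bind_commute_pmf)
  then have "emeasure (pair_pmf p q) S = (\<integral>\<^sup>+y. emeasure (map_pmf (\<lambda>x. (x, y)) p) S \<partial>q)"
    by (simp add: emeasure_bind_pmf)
  also have "\<dots> \<le> (\<integral>\<^sup>+y. ennreal b \<partial>q)"
    using assms by (intro nn_integral_mono_AE AE_pmfI)
      (auto simp: measure_pmf.emeasure_eq_measure vimage_def intro!: ennreal_leI)
  finally show ?thesis
    using b by (simp add: measure_pmf.emeasure_eq_measure)
qed

lemma delete_vertex_idem [simp]: "delete_vertex j (delete_vertex j A) = delete_vertex j A"
  by (intro ext) (simp add: delete_vertex_def)

lemma adjacency_matrix_sym: "adjacency_matrix e i j = adjacency_matrix e j i"
  by (simp add: adjacency_matrix_def min.commute max.commute)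

text \<open>
  The weights see no edge at \<open>j\<close>, so conditionally on the edges that avoid \<open>j\<close> they are constants.
\<close>

lemma prob_star_deviation:
  fixes P :: "nat \<Rightarrow> nat \<Rightarrow> real" and a :: "(nat \<Rightarrow> nat \<Rightarrow> real) \<Rightarrow> nat \<Rightarrow> real"
  assumes j: "j < n" and P: "\<And>i k. i < n \<Longrightarrow> k < n \<Longrightarrow> P i k = P k i \<and> P i k \<in> {0..1}"
    and a: "\<And>e. (\<Sum>l\<in>{..<n}-{j}. (a (delete_vertex j (adjacency_matrix e)) l)\<^sup>2) \<le> v"
    and v: "0 < v" and s: "0 < s"
  shows "measure (adjacency_pmf n P)
      {A. \<bar>\<Sum>l\<in>{..<n}-{j}. a (delete_vertex j A) l * (A l j - P l j)\<bar> \<ge> s} \<le> 2 * exp (- 2 * s\<^sup>2 / v)"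
    (is "measure _ ?S \<le> _")
proof -
  \<comment> \<open>\<open>g l\<close> is the ordered pair under which
    \<open>adjacency_matrix\<close> reads the edge between \<open>l\<close> and \<open>j\<close>;
    thus \<open>Z\<close> is the set of edges at \<open>j\<close>, and \<open>R\<close> holds the
    other edges.\<close>
  define g where "g l = (min l j, max l j)" for l
  define Z where "Z = g ` ({..<n}-{j})"
  define R where "R = vertex_pairs n - Z"
  define p where "p = (\<lambda>(i, k). P i k)"
  have inj: "inj_on g ({..<n}-{j})"
    by (auto simp: inj_on_def g_def min_def max_def split: if_splits)
  have Z_eq: "vertex_pairs n = Z \<union> R" and fin: "finite Z" "finite R" "Z \<inter> R = {}"
    using j finite_vertex_pairs
    by (auto simp: Z_def R_def g_def vertex_pairs_def min_def max_def)
  have pair_in_Z: "(min i k, max i k) \<in> Z" if "i = j \<or> k = j" "i \<noteq> k" "i < n" "k < n" for i k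
  proof -
    have "(min i k, max i k) = g (if i = j then k else i)"
      using that by (auto simp: g_def min.commute max.commute)
    then show ?thesis using that unfolding Z_def by auto
  qed
  have pair_notin_Z: "(min i k, max i k) \<notin> Z" if "i \<noteq> j" "k \<noteq> j" for i k
    using that by (auto simp: Z_def g_def min_def max_def split: if_splits)
  \<comment> \<open>The edge variables split into two independent blocks, indexed by
    \<open>Z\<close> and \<open>R\<close>. The second block is frozen as \<open>h\<close>
    below.\<close>
  have "adjacency_pmf n P = map_pmf (\<lambda>(f, h). adjacency_matrix (\<lambda>z. if z \<in> Z then f z else h z))
      (pair_pmf (Pi_pmf Z False (\<lambda>z. bernoulli_pmf (p z))) (Pi_pmf R False (\<lambda>z. bernoulli_pmf (p z))))"
    unfolding adjacency_pmf_def Z_eq p_def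
    by (subst Pi_pmf_union) (use fin in \<open>simp_all add: map_pmf_comp case_prod_unfold\<close>)
  then have "measure (adjacency_pmf n P) ?S =
      measure (pair_pmf (Pi_pmf Z False (\<lambda>z. bernoulli_pmf (p z))) (Pi_pmf R False (\<lambda>z. bernoulli_pmf (p z))))
        ((\<lambda>(f, h). adjacency_matrix (\<lambda>z. if z \<in> Z then f z else h z)) -` ?S)"
    by simp
  also have "\<dots> \<le> 2 * exp (- 2 * s\<^sup>2 / v)"
  proof (rule measure_pair_pmf_le)
    fix h
    define w where "w l = a (delete_vertex j (adjacency_matrix h)) l" for l
    \<comment> \<open>Carries the weights from the endpoints \<open>l\<close> to the edges
      \<open>g l\<close>, since Hoeffding's bound is applied over \<open>Z\<close>.\<close>
    define c where "c z = w (the_inv_into ({..<n}-{j}) g z)" for z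
    have cg: "c (g l) = w l" if "l \<in> {..<n}-{j}" for l
      unfolding c_def using inj that by (simp add: the_inv_into_f_f)
    \<comment> \<open>With row and column \<open>j\<close> zeroed, no entry reads an edge in
      \<open>Z\<close>, so the weights depend on \<open>h\<close> alone.\<close>
    have del: "delete_vertex j (adjacency_matrix (\<lambda>z. if z \<in> Z then f z else h z)) =
        delete_vertex j (adjacency_matrix h)" for f
      by (intro ext) (auto simp: delete_vertex_def adjacency_matrix_def pair_notin_Z)
    have entry: "adjacency_matrix (\<lambda>z. if z \<in> Z then f z else h z) l j = of_bool (f (g l))"
      "P l j = p (g l)" if "l \<in> {..<n}-{j}" for f l
      using that pair_in_Z[of l j] P[of l j] j
      by (auto simp: adjacency_matrix_def g_def p_def min_def max_def)
    have "(\<Sum>l\<in>{..<n}-{j}. a (delete_vertex j (adjacency_matrix (\<lambda>z. if z \<in> Z then f z else h z))) l *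
          (adjacency_matrix (\<lambda>z. if z \<in> Z then f z else h z) l j - P l j)) =
        (\<Sum>l\<in>{..<n}-{j}. c (g l) * (of_bool (f (g l)) - p (g l)))" for f
      by (intro sum.cong refl) (simp only: del entry cg w_def)
    then have "{f. (f, h) \<in> (\<lambda>(f, h). adjacency_matrix (\<lambda>z. if z \<in> Z then f z else h z)) -` ?S} =
        {f. \<bar>\<Sum>l\<in>{..<n}-{j}. c (g l) * (of_bool (f (g l)) - p (g l))\<bar> \<ge> s}"
      by (simp only: vimage_eq mem_Collect_eq prod.case)
    also have "\<dots> = {f. \<bar>\<Sum>z\<in>Z. c z * (of_bool (f z) - p z)\<bar> \<ge> s}"
      unfolding Z_def by (subst sum.reindex[OF inj]) simp
    finally have eq: "{f. (f, h) \<in> (\<lambda>(f, h). adjacency_matrix (\<lambda>z. if z \<in> Z then f z else h z)) -` ?S} =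
        {f. \<bar>\<Sum>z\<in>Z. c z * (of_bool (f z) - p z)\<bar> \<ge> s}" .
    have "(\<Sum>z\<in>Z. (c z)\<^sup>2) = (\<Sum>l\<in>{..<n}-{j}. (w l)\<^sup>2)"
      unfolding Z_def sum.reindex[OF inj] by (intro sum.cong) (simp_all add: cg)
    also have "\<dots> \<le> v" using a by (simp add: w_def)
    finally have sq: "(\<Sum>z\<in>Z. (c z)\<^sup>2) \<le> v" .
    have p: "p z \<in> {0..1}" if "z \<in> Z" for z
      using that P j by (auto simp: Z_def p_def g_def)
    show "measure (Pi_pmf Z False (\<lambda>z. bernoulli_pmf (p z)))
        {f. (f, h) \<in> (\<lambda>(f, h). adjacency_matrix (\<lambda>z. if z \<in> Z then f z else h z)) -` ?S}
        \<le> 2 * exp (- 2 * s\<^sup>2 / v)"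
      unfolding eq by (intro Hoeffding_Pi_pmf_bernoulli fin(1) p sq v s)
  qed
  finally show ?thesis .
qed

section \<open>Cells of a piecewise Lipschitz graphon\<close>

text \<open>Compactness covers the closed hull of \<open>B\<close> by finitely many balls, and their
  traces on \<open>B\<close> are the cells. They form a cover and may overlap.\<close>

lemma interval_cells:
  fixes B :: "real set"
  assumes B: "is_interval B" "bounded B" "0 < measure lborel B" and r: "0 < r"
  shows "\<exists>\<Q>. finite \<Q> \<and> B \<subseteq> \<Union>\<Q> \<and> (\<forall>Q\<in>\<Q>. Q \<in> sets borel \<and> Q \<subseteq> B \<and> 0 < measure lborel Q) \<and>
    (\<forall>Q\<in>\<Q>. \<forall>x\<in>Q. \<forall>x'\<in>Q. \<bar>x - x'\<bar> \<le> r)"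
proof -
  define a b where "a = Inf B" and "b = Sup B"
  have ne: "B \<noteq> {}" using B(3) by auto
  have bdd: "bdd_below B" "bdd_above B"
    using B(2) by (simp_all add: bounded_imp_bdd_below bounded_imp_bdd_above)
  have sub: "B \<subseteq> {a..b}"
    using bdd by (auto simp: a_def b_def intro: cInf_lower cSup_upper)
  have inner: "{a<..<b} \<subseteq> B"
  proof
    fix y assume y: "y \<in> {a<..<b}"
    then obtain u v where "u \<in> B" "u < y" "v \<in> B" "y < v"
      using ne bdd cInf_less_iff[of B y] less_cSup_iff[of B y] by (auto simp: a_def b_def)
    then show "y \<in> B"
      using B(1) unfolding is_interval_1 by (meson less_imp_le)
  qed
  have ab: "a < b"
  proof (rule ccontr)
    assume "\<not> a < b"
    then have "B \<subseteq> {a}" using sub by auto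
    then have "B = {a}" using ne by auto
    then show False using B(3) by simp
  qed
  have "B = {a<..<b} \<union> (B \<inter> {a, b})"
    using sub inner by auto
  also have "\<dots> \<in> sets borel"
    by (intro sets.Un borel_open open_greaterThanLessThan borel_closed finite_imp_closed) auto
  finally have borelB: "B \<in> sets borel" .
  obtain k where k: "finite k" "k \<subseteq> {a..b}" "{a..b} \<subseteq> (\<Union>c\<in>k. ball c (r / 2))"
    by (rule compactE_image[OF compact_Icc, of "{a..b}" "\<lambda>c. ball c (r / 2)" a b]) (use r in auto)
  let ?\<Q> = "(\<lambda>c. B \<inter> ball c (r / 2)) ` k"
  show ?thesis
  proof (intro exI[of _ ?\<Q>] conjI ballI)
    show "B \<subseteq> \<Union>?\<Q>" using sub k(3) by blast
  next
    fix Q assume "Q \<in> ?\<Q>"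
    then obtain c where c: "c \<in> k" "Q = B \<inter> ball c (r / 2)" by blast
    have Q: "Q \<in> sets borel" using borelB c by auto
    \<comment> \<open>The centre \<open>c\<close> lies in \<open>{a..b}\<close>, possibly at an end,
      so its ball meets \<open>{a<..<b}\<close> in a nonempty open interval, which gives the cell
      positive measure.\<close>
    define u v where "u = max a (c - r / 2)" and "v = min b (c + r / 2)"
    have uv: "u < v" using ab r c(1) k(2) by (auto simp: u_def v_def)
    have "{u<..<v} \<subseteq> Q"
      using inner by (auto simp: c(2) u_def v_def dist_real_def abs_if field_simps)
    moreover have "emeasure lborel Q < \<infinity>"
      using B(2) c(2) by (intro emeasure_bounded_finite) (auto intro: bounded_subset)
    ultimately have "measure lborel {u<..<v} \<le> measure lborel Q"
      using Q by (intro measure_mono_fmeasurable) (auto simp: fmeasurable_def)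
    then show "0 < measure lborel Q" "Q \<in> sets borel" "Q \<subseteq> B"
      using uv Q c by auto
  next
    fix Q x x' assume "Q \<in> ?\<Q>" "x \<in> Q" "x' \<in> Q"
    then show "\<bar>x - x'\<bar> \<le> r" by (auto simp: dist_real_def abs_if split: if_splits)
  next
    show "finite ?\<Q>" using k(1) by simp
  qed
qed

text \<open>Each block of the partition is cut into short cells. The second argument is common to
  both values, so the Lipschitz bound only sees the diameter of the cell.\<close>

lemma piecewise_lipschitz_cells:
  assumes W: "piecewise_lipschitz W" and d: "0 < d"
  obtains \<Q> :: "real set set" where "finite \<Q>" "{0..1} \<subseteq> \<Union>\<Q>"
    "\<And>Q. Q \<in> \<Q> \<Longrightarrow> Q \<in> sets borel \<and> Q \<subseteq> {0..1} \<and> 0 < measure lborel Q"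
    "\<And>Q x x' y. Q \<in> \<Q> \<Longrightarrow> x \<in> Q \<Longrightarrow> x' \<in> Q \<Longrightarrow> y \<in> {0..1} \<Longrightarrow> \<bar>W x y - W x' y\<bar> \<le> d"
proof -
  obtain c \<B> where c: "c \<ge> 0" and \<B>: "finite \<B>" "partition_on {0..1} \<B>"
      "\<forall>B\<in>\<B>. is_interval B \<and> 0 < measure lborel B"
    and lip: "\<forall>B\<in>\<B>. \<forall>B'\<in>\<B>. \<forall>x\<in>B. \<forall>x'\<in>B. \<forall>y\<in>B'. \<forall>y'\<in>B'.
           \<bar>W x y - W x' y'\<bar> \<le> c * (\<bar>x - x'\<bar> + \<bar>y - y'\<bar>)"
    using W unfolding piecewise_lipschitz_def by (elim exE conjE) (rule that)
  have un: "\<Union>\<B> = {0..1}" using \<B>(2) by (simp add: partition_on_def)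
  \<comment> \<open>The denominator is \<open>c + 1\<close> because \<open>c\<close> may be
    0.\<close>
  define r where "r = d / (c + 1)"
  have r: "0 < r" "c * r \<le> d"
    using c d by (simp_all add: r_def field_simps)
  have "\<forall>B\<in>\<B>. \<exists>\<Q>. finite \<Q> \<and> B \<subseteq> \<Union>\<Q> \<and>
      (\<forall>Q\<in>\<Q>. Q \<in> sets borel \<and> Q \<subseteq> B \<and> 0 < measure lborel Q) \<and>
      (\<forall>Q\<in>\<Q>. \<forall>x\<in>Q. \<forall>x'\<in>Q. \<bar>x - x'\<bar> \<le> r)"
  proof
    fix B assume B: "B \<in> \<B>"
    have "bounded B"
      using un B by (intro bounded_subset[OF bounded_closed_interval[of 0 1]]) auto
    then show "\<exists>\<Q>. finite \<Q> \<and> B \<subseteq> \<Union>\<Q> \<and>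
        (\<forall>Q\<in>\<Q>. Q \<in> sets borel \<and> Q \<subseteq> B \<and> 0 < measure lborel Q) \<and>
        (\<forall>Q\<in>\<Q>. \<forall>x\<in>Q. \<forall>x'\<in>Q. \<bar>x - x'\<bar> \<le> r)"
      using \<B>(3) B r(1) by (intro interval_cells) auto
  qed
  from bchoice[OF this] obtain f where f0: "\<forall>B\<in>\<B>. finite (f B) \<and> B \<subseteq> \<Union>(f B) \<and>
      (\<forall>Q\<in>f B. Q \<in> sets borel \<and> Q \<subseteq> B \<and> 0 < measure lborel Q) \<and>
      (\<forall>Q\<in>f B. \<forall>x\<in>Q. \<forall>x'\<in>Q. \<bar>x - x'\<bar> \<le> r)"
    by (elim exE)
  have f: "finite (f B)" "B \<subseteq> \<Union>(f B)"
      "\<forall>Q\<in>f B. Q \<in> sets borel \<and> Q \<subseteq> B \<and> 0 < measure lborel Q"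
      "\<forall>Q\<in>f B. \<forall>x\<in>Q. \<forall>x'\<in>Q. \<bar>x - x'\<bar> \<le> r" if "B \<in> \<B>" for B
    using f0[rule_format, OF that] by - (elim conjE, assumption)+
  show ?thesis
  proof (rule that[of "\<Union>(f ` \<B>)"])
    show "{0..1} \<subseteq> \<Union>(\<Union>(f ` \<B>))"
    proof
      fix y :: real assume "y \<in> {0..1}"
      then obtain B where "B \<in> \<B>" "y \<in> B" using un by blast
      then show "y \<in> \<Union>(\<Union>(f ` \<B>))" using f(2)[of B] by blast
    qed
  next
    fix Q assume "Q \<in> \<Union>(f ` \<B>)"
    then obtain B where "B \<in> \<B>" "Q \<in> f B" by blast
    then show "Q \<in> sets borel \<and> Q \<subseteq> {0..1} \<and> 0 < measure lborel Q"
      using f(3)[of B] un by blast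
  next
    fix Q x x' y assume Q: "Q \<in> \<Union>(f ` \<B>)" "x \<in> Q" "x' \<in> Q" and y: "y \<in> {0..1::real}"
    then obtain B B' where B: "B \<in> \<B>" "Q \<in> f B" "B' \<in> \<B>" "y \<in> B'"
      using un by blast
    then have "\<bar>W x y - W x' y\<bar> \<le> c * \<bar>x - x'\<bar>"
      using lip[rule_format, of B B' x x' y y] f(3)[of B] Q by auto
    also have "\<dots> \<le> c * r"
      using f(4)[OF B(1), rule_format, OF B(2) Q(2,3)] c by (intro mult_left_mono)
    finally show "\<bar>W x y - W x' y\<bar> \<le> d" using r by linarith
  next
    show "finite (\<Union>(f ` \<B>))" using \<B>(1) f(1) by blast
  qed
qed

section \<open>Independent sample points and cell counts\<close>

text \<open>Independence amounts to the joint law being the product of the marginals; the tuple of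
  coordinates has law \<open>PiM I M\<close>, and coordinate \<open>i\<close> has law
  \<open>M i\<close>.\<close>

lemma indep_vars_PiM_components:
  assumes I: "I \<noteq> {}" "finite I" and M: "\<And>i. i \<in> I \<Longrightarrow> prob_space (M i)"
  shows "prob_space.indep_vars (PiM I M) M (\<lambda>i x. x i) I"
proof -
  interpret P: prob_space "PiM I M" by (rule prob_space_PiM) (rule M)
  have "distr (PiM I M) (PiM I M) (\<lambda>x. \<lambda>i\<in>I. x i) = PiM I M"
    by (subst distr_cong[where g = "\<lambda>x. x"]) (auto simp: space_PiM)
  also have "\<dots> = PiM I (\<lambda>i. distr (PiM I M) (M i) (\<lambda>x. x i))"
    using I M by (intro PiM_cong refl) (simp add: distr_PiM_component)
  finally show ?thesis
    using I by (subst P.indep_vars_iff_distr_eq_PiM') auto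
qed

lemma component_measurable_latent_law:
  "l < n \<Longrightarrow> (\<lambda>x. x l) \<in> latent_law n \<rightarrow>\<^sub>M restrict_space lborel {0..1}"
  unfolding latent_law_def by (intro measurable_component_singleton) auto

lemma count_measurable_latent_law:
  assumes "Q \<in> sets borel" "Q \<subseteq> {0..1}"
  shows "(\<lambda>x. real (card {l \<in> {..<n}. x l \<in> Q})) \<in> borel_measurable (latent_law n)"
proof -
  have "Q \<in> sets (restrict_space lborel {0..1})"
    using assms by (subst sets_restrict_space_iff) auto
  then have "(\<lambda>x. indicator Q (x l) :: real) \<in> borel_measurable (latent_law n)" if "l < n" for l
    using that by (intro measurable_compose[OF component_measurable_latent_law] borel_measurable_indicator)
  then have "(\<lambda>x. \<Sum>l<n. indicator Q (x l) :: real) \<in> borel_measurable (latent_law n)"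
    by (intro borel_measurable_sum) auto
  moreover have "(\<lambda>x. real (card {l \<in> {..<n}. x l \<in> Q})) = (\<lambda>x. \<Sum>l<n. indicator Q (x l))"
    by (simp add: indicator_def Int_def)
  ultimately show ?thesis by (simp only:)
qed

text \<open>The count is a sum of independent indicators with total mean \<open>p * n\<close>; this
  is Hoeffding's lower tail at half the mean.\<close>

lemma prob_few_points_in_cell:
  assumes Q: "Q \<in> sets borel" "Q \<subseteq> {0..1}" and n: "0 < n"
  defines "p \<equiv> measure lborel Q"
  shows "measure (latent_law n) {x \<in> space (latent_law n). real (card {l \<in> {..<n}. x l \<in> Q}) \<le> p / 2 * real n}
    \<le> exp (- (p\<^sup>2 / 2) * real n)"
proof -
  let ?U = "restrict_space lborel {0..1::real}"
  interpret L: prob_space "latent_law n" by (rule prob_space_latent_law)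
  have QU: "Q \<in> sets ?U"
    using Q by (subst sets_restrict_space_iff) auto
  have comp: "distr (latent_law n) ?U (\<lambda>x. x l) = ?U" if "l < n" for l
    unfolding latent_law_def using that by (intro distr_PiM_component prob_space_unit_interval) auto
  have E: "L.expectation (\<lambda>x. indicator Q (x l)) = p" if "l < n" for l
  proof -
    have "L.expectation (\<lambda>x. indicator Q (x l)) = integral\<^sup>L (distr (latent_law n) ?U (\<lambda>x. x l)) (indicator Q :: real \<Rightarrow> real)"
      using QU that by (intro integral_distr[symmetric] component_measurable_latent_law) auto
    also have "\<dots> = measure ?U (Q \<inter> space ?U)"
      unfolding comp[OF that] by (rule Bochner_Integration.integral_indicator)
    also have "Q \<inter> space ?U = Q"
      using sets.sets_into_space[OF QU] by blast
    also have "measure ?U Q = p"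
      unfolding p_def using Q by (intro measure_restrict_space) auto
    finally show ?thesis .
  qed
  have "L.indep_vars (\<lambda>_. ?U) (\<lambda>l x. x l) {..<n}"
    unfolding latent_law_def using n
    by (intro indep_vars_PiM_components prob_space_unit_interval) auto
  then have ind: "L.indep_vars (\<lambda>_. borel) (\<lambda>l x. indicator Q (x l) :: real) {..<n}"
    using QU by (intro L.indep_vars_compose2[where Y = "\<lambda>_. indicator Q"]) auto
  interpret Hoeffding_ineq "latent_law n" "{..<n}" "\<lambda>l x. indicator Q (x l)" "\<lambda>_. 0" "\<lambda>_. 1" "p * real n"
  proof unfold_locales
    show "p * real n \<equiv> (\<Sum>l<n. L.expectation (\<lambda>x. indicator Q (x l)))"
      by (intro eq_reflection) (simp add: E)
  qed (use ind in \<open>simp_all add: indicator_def\<close>)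
  have sum: "(\<Sum>l<n. indicator Q (x l)) = real (card {l \<in> {..<n}. x l \<in> Q})" for x
    by (simp add: indicator_def Int_def)
  have p: "0 \<le> p" by (simp add: p_def)
  have H: "L.prob {x \<in> space (latent_law n). (\<Sum>l<n. indicator Q (x l)) \<le> p * real n - p / 2 * real n}
      \<le> exp (- 2 * (p / 2 * real n)\<^sup>2 / real n)"
    using Hoeffding_ineq_le[of "p / 2 * real n"] n p by simp
  have e1: "- 2 * (p / 2 * real n)\<^sup>2 / real n = - (p\<^sup>2 / 2) * real n"
    using n by (simp add: power2_eq_square field_simps)
  have e2: "p * real n - p / 2 * real n = p / 2 * real n"
    by (simp add: field_simps)
  show ?thesis
    using H by (simp only: sum e1 e2)
qed

section \<open>Neighborhoods of a typical graph\<close>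

text \<open>The least \<open>q\<close> in \<open>quantile\<close> exists since the level sets change
  only at values of \<open>f\<close>: every admissible \<open>q\<close> can be lowered to an
  admissible value of \<open>f\<close>, and there are finitely many of those. Positivity of
  \<open>h\<close> makes the level sets of admissible \<open>q\<close> nonempty, and
  \<open>h \<le> 1\<close> makes the largest value admissible.\<close>

lemma
  fixes f :: "'i \<Rightarrow> real"
  assumes I: "finite I" "I \<noteq> {}" and h: "0 < h" "h \<le> 1"
  shows card_le_quantile: "h * real (card I) \<le> real (card {i \<in> I. f i \<le> quantile h f I})"
    and quantile_le: "\<And>q. h * real (card I) \<le> real (card {i \<in> I. f i \<le> q}) \<Longrightarrow> quantile h f I \<le> q"
proof -
  define S where "S = {q. h * real (card I) \<le> real (card {i \<in> I. f i \<le> q})}"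
  have attained: "\<exists>m\<in>f ` I. m \<in> S \<and> m \<le> q" if "q \<in> S" for q
  proof -
    have "0 < h * real (card I)" using I h by (simp add: card_gt_0_iff)
    then have "0 < card {i \<in> I. f i \<le> q}" using that unfolding S_def by auto
    then have ne: "{i \<in> I. f i \<le> q} \<noteq> {}" by force
    define m where "m = Max (f ` {i \<in> I. f i \<le> q})"
    have m: "m \<in> f ` {i \<in> I. f i \<le> q}"
      unfolding m_def using ne I by (intro Max_in) auto
    have "f i \<le> m" if "i \<in> I" "f i \<le> q" for i
      unfolding m_def using that I by (intro Max_ge) auto
    then have "{i \<in> I. f i \<le> m} = {i \<in> I. f i \<le> q}" using m by auto
    then have "m \<in> S" using that by (simp add: S_def)
    then show ?thesis using m by blast
  qed
  have "{i \<in> I. f i \<le> Max (f ` I)} = I" using I by auto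
  then have "Max (f ` I) \<in> S" using h by (simp add: S_def mult_left_le_one_le)
  then have ne: "f ` I \<inter> S \<noteq> {}" using attained by blast
  define q0 where "q0 = Min (f ` I \<inter> S)"
  have q0: "q0 \<in> S" unfolding q0_def using Min_in[OF _ ne] I by auto
  have le: "q0 \<le> q" if "q \<in> S" for q
    using attained[OF that] I unfolding q0_def by (meson IntI Min_le finite_Int finite_imageI order_trans)
  have "quantile h f I = q0"
    unfolding quantile_def using q0 le by (intro Least_equality) (auto simp: S_def)
  then show "h * real (card I) \<le> real (card {i \<in> I. f i \<le> quantile h f I})"
    and "\<And>q. h * real (card I) \<le> real (card {i \<in> I. f i \<le> q}) \<Longrightarrow> quantile h f I \<le> q"
    using q0 le by (auto simp: S_def)
qed

section \<open>Near-twins and codegrees\<close>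

definition prob_matrix :: "nat \<Rightarrow> (nat \<Rightarrow> nat \<Rightarrow> real) \<Rightarrow> bool" where
  "prob_matrix n P \<longleftrightarrow> (\<forall>i<n. \<forall>k<n. P i k = P k i \<and> P i k \<in> {0..1})"

text \<open>The form in which the piecewise Lipschitz condition enters the estimates for a fixed
  matrix. For \<open>d \<ge> 0\<close> vertex \<open>i\<close> counts as its own twin, which is why
  later arguments exclude it.\<close>

definition has_twins :: "nat \<Rightarrow> real \<Rightarrow> real \<Rightarrow> (nat \<Rightarrow> nat \<Rightarrow> real) \<Rightarrow> bool" where
  "has_twins n d b P \<longleftrightarrow> (\<forall>i<n. b * real n \<le> real (card {k \<in> {..<n}. \<forall>l<n. \<bar>P i l - P k l\<bar> \<le> d}))"

definition codegree :: "nat \<Rightarrow> (nat \<Rightarrow> nat \<Rightarrow> real) \<Rightarrow> nat \<Rightarrow> nat \<Rightarrow> real" where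
  "codegree n P i k = mat_square n P i k / real n"

lemma prob_matrix_sym: "prob_matrix n P \<Longrightarrow> i < n \<Longrightarrow> k < n \<Longrightarrow> P i k = P k i"
  by (simp add: prob_matrix_def)

lemma prob_matrix_bounds: "prob_matrix n P \<Longrightarrow> i < n \<Longrightarrow> k < n \<Longrightarrow> 0 \<le> P i k \<and> P i k \<le> 1"
  by (simp add: prob_matrix_def)

lemma codegree_sym: "prob_matrix n P \<Longrightarrow> i < n \<Longrightarrow> k < n \<Longrightarrow> codegree n P i k = codegree n P k i"
  unfolding codegree_def mat_square_def
  by (intro arg_cong2[where f = "(/)"] sum.cong refl) (simp add: prob_matrix_sym)

lemma codegree_lipschitz:
  assumes P: "prob_matrix n P" and i: "i < n" "i' < n" "k < n"
    and d: "\<And>l. l < n \<Longrightarrow> \<bar>P i l - P i' l\<bar> \<le> d"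
  shows "\<bar>codegree n P i k - codegree n P i' k\<bar> \<le> d"
proof -
  have "\<bar>mat_square n P i k - mat_square n P i' k\<bar> = \<bar>\<Sum>l<n. (P i l - P i' l) * P l k\<bar>"
    by (simp add: mat_square_def sum_subtractf left_diff_distrib)
  also have "\<dots> \<le> (\<Sum>l<n. d)"
  proof (rule order_trans[OF sum_abs] sum_mono)+
    fix l assume l: "l \<in> {..<n}"
    have "\<bar>(P i l - P i' l) * P l k\<bar> = \<bar>P i l - P i' l\<bar> * P l k"
      using prob_matrix_bounds[OF P, of l k] l i by (simp add: abs_mult)
    also have "\<dots> \<le> \<bar>P i l - P i' l\<bar>"
      using prob_matrix_bounds[OF P, of l k] l i by (intro mult_right_le_one_le) auto
    also have "\<dots> \<le> d" using d l by simp
    finally show "\<bar>(P i l - P i' l) * P l k\<bar> \<le> d" .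
  qed
  finally have "\<bar>mat_square n P i k - mat_square n P i' k\<bar> \<le> real n * d" by simp
  then show ?thesis
    using i unfolding codegree_def diff_divide_distrib[symmetric] by (simp add: field_simps)
qed

text \<open>Supplies a replacement for an index at which no estimate is available: there are more
  twins than elements of \<open>F\<close>.\<close>

lemma twin_avoiding:
  assumes "has_twins n d b P" "i < n" "finite F" "real (card F) < b * real n"
  obtains k where "k < n" "k \<notin> F" "\<And>l. l < n \<Longrightarrow> \<bar>P i l - P k l\<bar> \<le> d"
proof -
  let ?T = "{k \<in> {..<n}. \<forall>l<n. \<bar>P i l - P k l\<bar> \<le> d}"
  have "card F < card ?T"
    using assms(1,2,4) unfolding has_twins_def by force
  then have "\<not> ?T \<subseteq> F"
    using card_mono[OF assms(3), of ?T] by auto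
  then show ?thesis using that by blast
qed

text \<open>
  The squared distance of rows \<open>i\<close> and \<open>i'\<close> is
  \<open>codegree i i - codegree i i' - codegree i' i + codegree i' i'\<close>; twins of \<open>i\<close> and \<open>i'\<close> replace
  the second indices, which the neighborhood distance does not control.
\<close>

lemma rows_close_if_codegrees_close:
  assumes P: "prob_matrix n P" and ij: "i < n" "i' < n" "j < n"
    and tw1: "has_twins n d1 b1 P" and tw2: "has_twins n d2 b2 P"
    and b: "0 < b1" "3 < b2 * real n" and d1: "0 \<le> d1"
    and close: "\<And>k. k < n \<Longrightarrow> k \<notin> {i, i', j} \<Longrightarrow> \<bar>codegree n P i k - codegree n P i' k\<bar> \<le> \<eta>"
    and small: "2 * \<eta> + 4 * d2 \<le> b1 * d1\<^sup>2"
  shows "\<bar>P i j - P i' j\<bar> \<le> 3 * d1"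
proof -
  have n: "0 < real n" using ij by simp
  \<comment> \<open>The index \<open>u\<close> may be one of \<open>i\<close>, \<open>i'\<close>,
    \<open>j\<close>, where \<open>close\<close> is silent. A twin \<open>k\<close> outside these
    three vertices replaces it, at cost \<open>d2\<close> in each of the two codegrees.\<close>
  have swap: "\<bar>codegree n P i u - codegree n P i' u\<bar> \<le> \<eta> + 2 * d2" if u: "u < n" for u
  proof -
    have "real (card {i, i', j}) \<le> 3" by (auto simp: card_insert_if)
    then obtain k where k: "k < n" "k \<notin> {i, i', j}" "\<And>l. l < n \<Longrightarrow> \<bar>P u l - P k l\<bar> \<le> d2"
      using twin_avoiding[OF tw2 u, of "{i, i', j}"] b by auto
    have "\<bar>codegree n P v u - codegree n P v k\<bar> \<le> d2" if "v < n" for v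
      using codegree_lipschitz[OF P u k(1) that k(3)] P u k that by (simp add: codegree_sym)
    from this[OF ij(1)] this[OF ij(2)] close[OF k(1,2)] show ?thesis by linarith
  qed
  have "(\<Sum>l<n. (P i l - P i' l)\<^sup>2) =
      mat_square n P i i - mat_square n P i i' - mat_square n P i' i + mat_square n P i' i'"
    unfolding mat_square_def sum_subtractf[symmetric] sum.distrib[symmetric]
    using ij by (intro sum.cong refl)
      (simp add: prob_matrix_sym[OF P, of _ i] prob_matrix_sym[OF P, of _ i'] power2_eq_square algebra_simps)
  \<comment> \<open>Pairing by the second index lets \<open>swap\<close> apply at \<open>i\<close>
    and at \<open>i'\<close>.\<close>
  also have "\<dots> = real n * ((codegree n P i i - codegree n P i' i) - (codegree n P i i' - codegree n P i' i'))"
    using n by (simp add: codegree_def field_simps)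
  also have "\<dots> \<le> real n * (2 * \<eta> + 4 * d2)"
    using swap[OF ij(1)] swap[OF ij(2)] by (intro mult_left_mono) linarith+
  also have "\<dots> \<le> real n * (b1 * d1\<^sup>2)"
    using small by (intro mult_left_mono) auto
  finally have L2: "(\<Sum>l<n. (P i l - P i' l)\<^sup>2) \<le> real n * (b1 * d1\<^sup>2)" .
  show ?thesis
  proof (rule ccontr)
    assume "\<not> ?thesis"
    then have big: "3 * d1 < \<bar>P i j - P i' j\<bar>" by simp
    \<comment> \<open>By symmetry, passing from column \<open>j\<close> to a twin column
      \<open>l\<close> changes each of the two entries by at most \<open>d1\<close>, so rows
      \<open>i\<close> and \<open>i'\<close> still differ by at least \<open>u\<close> there. As
      \<open>u > d1\<close> and there are at least \<open>b1 * n\<close> such columns, this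
      contradicts \<open>L2\<close>.\<close>
    define u where "u = \<bar>P i j - P i' j\<bar> - 2 * d1"
    have u: "d1 < u" using big by (simp add: u_def)
    let ?T = "{k \<in> {..<n}. \<forall>l<n. \<bar>P j l - P k l\<bar> \<le> d1}"
    have "u\<^sup>2 \<le> (P i l - P i' l)\<^sup>2" if l: "l \<in> ?T" for l
    proof -
      have "\<bar>P i j - P i l\<bar> \<le> d1" "\<bar>P i' j - P i' l\<bar> \<le> d1"
        using l ij by (auto simp: prob_matrix_sym[OF P, of i] prob_matrix_sym[OF P, of i'])
      then have "u \<le> \<bar>P i l - P i' l\<bar>" unfolding u_def by linarith
      then show ?thesis
        using u d1 by (metis abs_ge_zero abs_of_nonneg less_eq_real_def order_trans power2_abs power_mono)
    qed
    then have "real (card ?T) * u\<^sup>2 \<le> (\<Sum>l\<in>?T. (P i l - P i' l)\<^sup>2)"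
      by (intro sum_bounded_below) auto
    also have "\<dots> \<le> (\<Sum>l<n. (P i l - P i' l)\<^sup>2)"
      by (intro sum_mono2) auto
    also note L2
    finally have "real (card ?T) * u\<^sup>2 \<le> real n * (b1 * d1\<^sup>2)" .
    moreover have "b1 * real n * u\<^sup>2 \<le> real (card ?T) * u\<^sup>2"
      using tw1 ij unfolding has_twins_def by (intro mult_right_mono) auto
    moreover have "b1 * real n * d1\<^sup>2 < b1 * real n * u\<^sup>2"
      using b n u d1 by (intro mult_strict_left_mono power_strict_mono) auto
    ultimately show False by (simp add: mult_ac)
  qed
qed

text \<open>The factors are exchanged one at a time: \<open>A i l * A l k - P i l * P l k = A i l *
  (A l k - P l k) + P l k * (A i l - P i l)\<close>. This leaves one star at \<open>k\<close> and
  one at \<open>i\<close>. The three correction terms, from \<open>l = k\<close>,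
  \<open>l = i\<close> and the deletion of \<open>j\<close>, cost at most \<open>1 / n\<close>
  each.\<close>

lemma codegree_estimate:
  assumes P: "prob_matrix n P" and A: "prob_matrix n A" "\<And>i. A i i = 0"
    and ik: "i < n" "j < n" "k < n" "i \<noteq> j" "k \<noteq> j"
    and S1: "\<bar>\<Sum>l\<in>{..<n}-{k}. A i l / real n * (A l k - P l k)\<bar> < t"
    and S2: "\<bar>\<Sum>l\<in>{..<n}-{i}. P l k / real n * (A l i - P l i)\<bar> < t"
  shows "\<bar>mat_square n (delete_vertex j A) i k / real n - codegree n P i k\<bar> \<le> 2 * t + 3 / real n"
proof -
  have n: "0 < real n" using ik by simp
  have "mat_square n (delete_vertex j A) i k = (\<Sum>l\<in>{..<n}-{j}. A i l * A l k)"
    unfolding mat_square_def using ik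
    by (intro sum.mono_neutral_cong_right) (auto simp: delete_vertex_def)
  also have "\<dots> = (\<Sum>l<n. A i l * A l k) - A i j * A j k"
    using ik by (simp add: sum_diff1)
  finally have "mat_square n (delete_vertex j A) i k - mat_square n P i k =
      (\<Sum>l<n. A i l * (A l k - P l k)) + (\<Sum>l<n. P l k * (A i l - P i l)) - A i j * A j k"
    by (simp add: mat_square_def sum_subtractf algebra_simps)
  also have "(\<Sum>l<n. A i l * (A l k - P l k)) = (\<Sum>l\<in>{..<n}-{k}. A i l * (A l k - P l k)) - A i k * P k k"
    using ik A by (simp add: sum.remove[of _ k])
  also have "(\<Sum>l<n. P l k * (A i l - P i l)) = (\<Sum>l<n. P l k * (A l i - P l i))"
    using ik by (intro sum.cong refl) (simp add: prob_matrix_sym[OF P, of i] prob_matrix_sym[OF A(1), of i])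
  also have "\<dots> = (\<Sum>l\<in>{..<n}-{i}. P l k * (A l i - P l i)) - P i k * P i i"
    using ik A by (simp add: sum.remove[of _ i])
  finally have "mat_square n (delete_vertex j A) i k / real n - codegree n P i k =
      (\<Sum>l\<in>{..<n}-{k}. A i l * (A l k - P l k)) / real n + (\<Sum>l\<in>{..<n}-{i}. P l k * (A l i - P l i)) / real n
      - (A i k * P k k + P i k * P i i + A i j * A j k) / real n"
    unfolding codegree_def
    by (simp only: diff_divide_distrib[symmetric] add_divide_distrib[symmetric]) (simp add: algebra_simps)
  moreover have "\<bar>(\<Sum>l\<in>{..<n}-{k}. A i l * (A l k - P l k)) / real n\<bar> < t"
    "\<bar>(\<Sum>l\<in>{..<n}-{i}. P l k * (A l i - P l i)) / real n\<bar> < t"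
    using S1 S2 by (simp_all add: sum_divide_distrib)
  moreover have "0 \<le> (A i k * P k k + P i k * P i i + A i j * A j k) / real n"
    "(A i k * P k k + P i k * P i i + A i j * A j k) / real n \<le> 3 / real n"
  proof -
    have "0 \<le> A i k * P k k \<and> A i k * P k k \<le> 1" "0 \<le> P i k * P i i \<and> P i k * P i i \<le> 1"
      "0 \<le> A i j * A j k \<and> A i j * A j k \<le> 1"
      using prob_matrix_bounds[OF P] prob_matrix_bounds[OF A(1)] ik by (auto intro: mult_le_one)
    then show "0 \<le> (A i k * P k k + P i k * P i i + A i j * A j k) / real n"
      "(A i k * P k k + P i k * P i i + A i j * A j k) / real n \<le> 3 / real n"
      using n by (auto intro!: divide_right_mono)
  qed
  ultimately show ?thesis by linarith
qed

section \<open>Size and accuracy of the neighborhoods\<close>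

lemma nbhd_subset: "nbhd C n A i j \<subseteq> {..<n} - {i, j}"
  by (auto simp: nbhd_def)

text \<open>The neighborhood of \<open>i\<close> uses no edge at \<open>j\<close>, which makes it
  admissible as a weight in the star at \<open>j\<close>.\<close>

lemma nbhd_delete_vertex: "nbhd C n (delete_vertex j A) i j = nbhd C n A i j"
proof -
  have "nbr_dist n (delete_vertex j A) j = nbr_dist n A j"
    by (intro ext) (simp add: nbr_dist_def)
  then show ?thesis by (simp add: nbhd_def)
qed

text \<open>There are \<open>n - 2\<close> candidates, and the quantile admits at least the fraction
  \<open>bandwidth C n\<close> of them. Later this bounds the squared weights of a neighborhood
  average.\<close>

lemma card_nbhd_ge:
  assumes n: "3 \<le> n" and i: "i < n" "j < n" "i \<noteq> j" and h: "0 < bandwidth C n" "bandwidth C n \<le> 1"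
  shows "bandwidth C n * (real n - 2) \<le> real (card (nbhd C n A i j))"
proof -
  have "card ({..<n} - {i, j}) = n - 2" using i by (simp add: card_Diff_subset)
  moreover from this have "{..<n} - {i, j} \<noteq> {}" using n by force
  ultimately show ?thesis
    using card_le_quantile[of "{..<n} - {i, j}" "bandwidth C n" "nbr_dist n A j i"] h n
    by (simp add: nbhd_def of_nat_diff)
qed

text \<open>Twins of \<open>i\<close> have empirical distance at most
  \<open>2 * \<sigma> + d\<close> from it. By \<open>b\<close> there are enough of them, even after
  discarding \<open>i\<close> and \<open>j\<close>, to keep the quantile at or below this value; a
  chosen \<open>i'\<close> is then as close, and returning to codegrees costs another
  \<open>2 * \<sigma>\<close>.\<close>

lemma nbhd_codegree_close:
  assumes P: "prob_matrix n P" and tw: "has_twins n d b P"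
    and n: "4 \<le> n" and i: "i < n" "j < n" "i \<noteq> j" and h: "0 < bandwidth C n" "bandwidth C n \<le> 1"
    and b: "bandwidth C n * (real n - 2) \<le> b * real n - 2"
    and est: "\<And>i k. i < n \<Longrightarrow> k < n \<Longrightarrow> i \<noteq> k \<Longrightarrow> i \<noteq> j \<Longrightarrow> k \<noteq> j \<Longrightarrow>
      \<bar>mat_square n (delete_vertex j A) i k / real n - codegree n P i k\<bar> \<le> \<sigma>"
    and i': "i' \<in> nbhd C n A i j" and k: "k < n" "k \<notin> {i, i', j}"
  shows "\<bar>codegree n P i k - codegree n P i' k\<bar> \<le> 4 * \<sigma> + d"
proof -
  let ?I = "{..<n} - {i, j}"
  have card_I: "card ?I = n - 2" using i by (simp add: card_Diff_subset)
  have i'_I: "i' \<in> ?I" using i' nbhd_subset by blast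
  have I_ne: "?I \<noteq> {}" using card_I n by force
  let ?T = "{k \<in> {..<n}. \<forall>l<n. \<bar>P i l - P k l\<bar> \<le> d}"
  have twin_dist: "nbr_dist n A j i m \<le> 2 * \<sigma> + d" if m: "m \<in> ?T - {i, j}" for m
  proof -
    \<comment> \<open>\<open>n \<ge> 4\<close> ensures that the maximum defining
      \<open>nbr_dist\<close> is over a nonempty set.\<close>
    have ne: "{..<n} - {i, m, j} \<noteq> {}"
    proof
      assume "{..<n} - {i, m, j} = {}"
      then have "card {..<n} \<le> card {i, m, j}" by (intro card_mono) auto
      also have "\<dots> \<le> 3" by (auto simp: card_insert_if)
      finally show False using n by simp
    qed
    have "\<bar>mat_square n (delete_vertex j A) i q / real n - mat_square n (delete_vertex j A) m q / real n\<bar>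
        \<le> 2 * \<sigma> + d" if q: "q \<in> {..<n} - {i, m, j}" for q
      using est[of i q] est[of m q] codegree_lipschitz[OF P, of i m q d] q m i by auto
    then show ?thesis
      unfolding nbr_dist_def using ne by (intro Max.boundedI) auto
  qed
  have "real (card ?T) \<le> real (card (?T - {i, j})) + 2"
  proof -
    have "card ?T \<le> card ((?T - {i, j}) \<union> {i, j})" by (intro card_mono) auto
    also have "\<dots> \<le> card (?T - {i, j}) + card {i, j}" by (rule card_Un_le)
    also have "card {i, j} = 2" using i by simp
    finally show ?thesis by linarith
  qed
  moreover have "card (?T - {i, j}) \<le> card {m \<in> ?I. nbr_dist n A j i m \<le> 2 * \<sigma> + d}"
    using twin_dist by (intro card_mono) auto
  moreover have "b * real n \<le> real (card ?T)" using tw i by (simp add: has_twins_def)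
  ultimately have "bandwidth C n * real (card ?I) \<le> real (card {m \<in> ?I. nbr_dist n A j i m \<le> 2 * \<sigma> + d})"
    using b n by (simp add: card_I of_nat_diff)
  then have "quantile (bandwidth C n) (nbr_dist n A j i) ?I \<le> 2 * \<sigma> + d"
    using I_ne h by (intro quantile_le) auto
  then have "nbr_dist n A j i i' \<le> 2 * \<sigma> + d"
    using i' by (auto simp: nbhd_def)
  moreover have "\<bar>mat_square n (delete_vertex j A) i k / real n - mat_square n (delete_vertex j A) i' k / real n\<bar>
      \<le> nbr_dist n A j i i'"
    unfolding nbr_dist_def using k by (intro Max_ge) auto
  ultimately show ?thesis
    using est[of i k] est[of i' k] k i i'_I by auto
qed

section \<open>Consistency\<close>

lemma latent_law_range: "x \<in> space (latent_law n) \<Longrightarrow> l < n \<Longrightarrow> x l \<in> {0..1}"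
  using measurable_space[OF component_measurable_latent_law] by (auto simp: space_restrict_space)

lemma prob_matrix_edge_prob:
  "graphon W \<Longrightarrow> x \<in> space (latent_law n) \<Longrightarrow> prob_matrix n (edge_prob W x)"
  using latent_law_range[of x n] by (simp add: prob_matrix_def edge_prob_def graphon_def)

lemma prob_matrix_adjacency_matrix: "prob_matrix n (adjacency_matrix e)"
  unfolding prob_matrix_def by (auto simp: adjacency_matrix_def min.commute max.commute)

text \<open>If every cell holds more than half of its expected number of points, the sample points
  sharing the cell of \<open>x i\<close> are enough twins of \<open>i\<close>. The exceptional
  probability is at most a finite sum of exponentially small terms. The set \<open>G n\<close> is
  described by cell counts, which makes it measurable.\<close>

lemma has_twins_likely:
  assumes W: "piecewise_lipschitz W" and d: "0 < d"
  obtains b :: real and G where "0 < b" "\<And>n. G n \<in> sets (latent_law n)"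
    "\<And>n x. x \<in> G n \<Longrightarrow> has_twins n d b (edge_prob W x)"
    "(\<lambda>n. measure (latent_law n) (space (latent_law n) - G n)) \<longlonglongrightarrow> 0"
proof -
  obtain \<Q> :: "real set set" where \<Q>: "finite \<Q>" "{0..1} \<subseteq> \<Union>\<Q>"
    and cell: "\<And>Q. Q \<in> \<Q> \<Longrightarrow> Q \<in> sets borel \<and> Q \<subseteq> {0..1} \<and> 0 < measure lborel Q"
    and osc: "\<And>Q x x' y. Q \<in> \<Q> \<Longrightarrow> x \<in> Q \<Longrightarrow> x' \<in> Q \<Longrightarrow> y \<in> {0..1} \<Longrightarrow> \<bar>W x y - W x' y\<bar> \<le> d"
    by (rule piecewise_lipschitz_cells[OF W d]) (rule that)
  \<comment> \<open>Half the smallest cell measure: positive because there are finitely many cells,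
    and independent of \<open>n\<close>.\<close>
  define b where "b = Min ((\<lambda>Q. measure lborel Q / 2) ` \<Q>)"
  have ne: "\<Q> \<noteq> {}" using \<Q>(2) by auto
  have b: "0 < b" unfolding b_def using ne \<Q>(1) cell by simp
  have b_le: "b \<le> measure lborel Q / 2" if "Q \<in> \<Q>" for Q
    unfolding b_def using that \<Q>(1) by (intro Min_le) auto
  define F where "F n Q = {x \<in> space (latent_law n).
      real (card {l \<in> {..<n}. x l \<in> Q}) \<le> measure lborel Q / 2 * real n}" for n Q
  have F: "F n Q \<in> sets (latent_law n)" if "Q \<in> \<Q>" for n Q
    unfolding F_def using cell[OF that]
    by (intro borel_measurable_le count_measurable_latent_law borel_measurable_const) auto
  have FU: "(\<Union>Q\<in>\<Q>. F n Q) \<in> sets (latent_law n)" for n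
    using F \<Q>(1) by (intro sets.finite_UN) auto
  let ?G = "\<lambda>n. space (latent_law n) - (\<Union>Q\<in>\<Q>. F n Q)"
  have twins: "has_twins n d b (edge_prob W x)" if x: "x \<in> ?G n" for n x
    unfolding has_twins_def
  proof (intro allI impI)
    fix i assume i: "i < n"
    have range: "x l \<in> {0..1}" if "l < n" for l
      using latent_law_range x that by blast
    then obtain Q where Q: "Q \<in> \<Q>" "x i \<in> Q" using \<Q>(2) i by blast
    have "b * real n \<le> measure lborel Q / 2 * real n"
      using b_le[OF Q(1)] by (intro mult_right_mono) auto
    also have "\<dots> \<le> real (card {l \<in> {..<n}. x l \<in> Q})"
      using x Q(1) by (auto simp: F_def)
    also have "\<dots> \<le> real (card {k \<in> {..<n}. \<forall>l<n. \<bar>edge_prob W x i l - edge_prob W x k l\<bar> \<le> d})"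
      using osc[OF Q] range by (intro of_nat_mono card_mono) (auto simp: edge_prob_def)
    finally show "b * real n \<le> \<dots>" .
  qed
  have bound: "measure (latent_law n) (space (latent_law n) - ?G n) \<le>
      (\<Sum>Q\<in>\<Q>. exp (- ((measure lborel Q)\<^sup>2 / 2) * real n))" if "0 < n" for n
  proof -
    interpret prob_space "latent_law n" by (rule prob_space_latent_law)
    have "space (latent_law n) - ?G n = (\<Union>Q\<in>\<Q>. F n Q)"
      by (auto simp: F_def)
    also have "measure (latent_law n) \<dots> \<le> (\<Sum>Q\<in>\<Q>. measure (latent_law n) (F n Q))"
      using F \<Q>(1) by (intro finite_measure_subadditive_finite) auto
    also have "\<dots> \<le> (\<Sum>Q\<in>\<Q>. exp (- ((measure lborel Q)\<^sup>2 / 2) * real n))"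
      unfolding F_def using cell that by (intro sum_mono prob_few_points_in_cell) auto
    finally show ?thesis .
  qed
  have "(\<lambda>n. exp (- ((measure lborel Q)\<^sup>2 / 2) * real n)) \<longlonglongrightarrow> 0" if "Q \<in> \<Q>" for Q
  proof -
    define p where "p = measure lborel Q"
    have "0 < p" using cell[OF that] by (simp add: p_def)
    then have "(\<lambda>n. exp (- (p\<^sup>2 / 2) * real n)) \<longlonglongrightarrow> 0" by real_asymp
    then show ?thesis by (simp only: p_def)
  qed
  then have lim: "(\<lambda>n. \<Sum>Q\<in>\<Q>. exp (- ((measure lborel Q)\<^sup>2 / 2) * real n)) \<longlonglongrightarrow> 0"
    by (intro tendsto_null_sum) auto
  have "(\<lambda>n. measure (latent_law n) (space (latent_law n) - ?G n)) \<longlonglongrightarrow> 0"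
    by (rule tendsto_sandwich[OF _ eventually_mono[OF eventually_gt_at_top[of 0] bound] tendsto_const lim])
      (simp add: measure_nonneg)
  with b twins show ?thesis
    using FU by (intro that[of b ?G]) auto
qed

section \<open>Typical graphs for fixed edge probabilities\<close>

text \<open>The weight function is applied to the matrix without \<open>j\<close>, so independence
  from the edges at \<open>j\<close> is built in.\<close>

definition star_deviation ::
    "nat \<Rightarrow> (nat \<Rightarrow> nat \<Rightarrow> real) \<Rightarrow> (nat \<Rightarrow> nat \<Rightarrow> real) \<Rightarrow> nat \<Rightarrow> ((nat \<Rightarrow> nat \<Rightarrow> real) \<Rightarrow> nat \<Rightarrow> real) \<Rightarrow> real" where
  "star_deviation n P A j a = \<bar>\<Sum>l\<in>{..<n}-{j}. a (delete_vertex j A) l * (A l j - P l j)\<bar>"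

definition nbhd_weight :: "real \<Rightarrow> nat \<Rightarrow> nat \<Rightarrow> nat \<Rightarrow> (nat \<Rightarrow> nat \<Rightarrow> real) \<Rightarrow> nat \<Rightarrow> real" where
  "nbhd_weight C n i j A l = indicator (nbhd C n A i j) l / real (card (nbhd C n A i j))"

text \<open>The first two stars feed the codegree estimate; the third is the noise in the average
  over the neighborhood of \<open>i\<close> computed without \<open>k\<close>.\<close>

definition typical_graph :: "real \<Rightarrow> nat \<Rightarrow> real \<Rightarrow> (nat \<Rightarrow> nat \<Rightarrow> real) \<Rightarrow> (nat \<Rightarrow> nat \<Rightarrow> real) \<Rightarrow> bool" where
  "typical_graph C n t P A \<longleftrightarrow> (\<forall>i<n. \<forall>k<n. i \<noteq> k \<longrightarrow>
     star_deviation n P A k (\<lambda>M l. M i l / real n) < t \<and>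
     star_deviation n P A i (\<lambda>M l. P l k / real n) < t \<and>
     star_deviation n P A k (nbhd_weight C n i k) < t)"

text \<open>The error splits into noise, below \<open>t\<close> in a typical graph, and bias, at
  most \<open>3 * d1\<close> because the rows of neighbors nearly agree at \<open>j\<close>.\<close>

lemma nbhd_average_close:
  assumes P: "prob_matrix n P" and A: "prob_matrix n A" "\<And>i. A i i = 0"
    and tw1: "has_twins n d1 b1 P" and tw2: "has_twins n t b2 P"
    and b: "0 < b1" "3 < b2 * real n" "bandwidth C n * (real n - 2) \<le> b2 * real n - 2"
    and h: "0 < bandwidth C n" "bandwidth C n \<le> 1"
    and n: "4 \<le> n" "1 / real n \<le> t" and d1: "0 \<le> d1" "46 * t \<le> b1 * d1\<^sup>2"
    and typical: "typical_graph C n t P A"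
    and ij: "i < n" "j < n" "i \<noteq> j"
  shows "\<bar>P i j - 1 / real (card (nbhd C n A i j)) * (\<Sum>i'\<in>nbhd C n A i j. A i' j)\<bar> \<le> 3 * d1 + t"
proof -
  let ?N = "nbhd C n A i j"
  have "\<bar>mat_square n (delete_vertex j A) u k / real n - codegree n P u k\<bar> \<le> 5 * t"
    if "u < n" "k < n" "u \<noteq> k" "u \<noteq> j" "k \<noteq> j" for u k
  proof -
    have "star_deviation n P A k (\<lambda>M l. M u l / real n) < t"
      "star_deviation n P A u (\<lambda>M l. P l k / real n) < t"
      using typical that unfolding typical_graph_def by blast+
    \<comment> \<open>Here \<open>M\<close> is \<open>A\<close> with vertex \<open>k\<close>
      deleted; as \<open>u\<close> and \<open>l\<close> differ from \<open>k\<close>, the weight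
      \<open>M u l\<close> is \<open>A u l\<close>.\<close>
    moreover have "star_deviation n P A k (\<lambda>M l. M u l / real n) =
        \<bar>\<Sum>l\<in>{..<n}-{k}. A u l / real n * (A l k - P l k)\<bar>"
      unfolding star_deviation_def using that
      by (intro arg_cong[where f = abs] sum.cong refl) (simp add: delete_vertex_def)
    ultimately have "\<bar>mat_square n (delete_vertex j A) u k / real n - codegree n P u k\<bar> \<le> 2 * t + 3 / real n"
      using codegree_estimate[OF P A, of u j k t] that ij unfolding star_deviation_def by simp
    then show ?thesis using n(2) by simp
  qed
  \<comment> \<open>The codegree error \<open>2 * t + 3 / n \<le> 5 * t\<close> yields
    \<open>4 * (5 * t) + t = 21 * t\<close> for neighbors; with twins of accuracy \<open>t\<close>
    the row comparison needs \<open>2 * 21 * t + 4 * t = 46 * t\<close>, the source of the constant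
    46.\<close>
  then have codeg: "\<bar>codegree n P i k - codegree n P i' k\<bar> \<le> 4 * (5 * t) + t"
    if "i' \<in> ?N" "k < n" "k \<notin> {i, i', j}" for i' k
    using nbhd_codegree_close[OF P tw2 n(1) ij h b(3), of A "5 * t" i' k] that by blast
  have rows: "\<bar>P i' j - P i j\<bar> \<le> 3 * d1" if i': "i' \<in> ?N" for i'
  proof -
    have "i' < n" using i' nbhd_subset by blast
    then have "\<bar>P i j - P i' j\<bar> \<le> 3 * d1"
      using rows_close_if_codegrees_close[OF P ij(1) _ ij(2) tw1 tw2 b(1,2) d1(1) codeg[OF i']] d1(2)
      by simp
    then show ?thesis by linarith
  qed
  define c where "c = real (card ?N)"
  have "0 < bandwidth C n * (real n - 2)" using h n by simp
  also have "\<dots> \<le> c" unfolding c_def using ij h n by (intro card_nbhd_ge) auto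
  finally have c: "0 < c" .
  have "star_deviation n P A j (nbhd_weight C n i j) =
      \<bar>\<Sum>l\<in>{..<n}-{j}. indicator ?N l / c * (A l j - P l j)\<bar>"
    by (simp add: star_deviation_def nbhd_weight_def nbhd_delete_vertex c_def)
  also have "(\<Sum>l\<in>{..<n}-{j}. indicator ?N l / c * (A l j - P l j)) = (\<Sum>l\<in>?N. (A l j - P l j) / c)"
    using nbhd_subset[of C n A i j] by (intro sum.mono_neutral_cong_right) auto
  finally have dev: "\<bar>\<Sum>l\<in>?N. (A l j - P l j) / c\<bar> < t"
    using typical ij unfolding typical_graph_def by metis
  have "\<bar>\<Sum>l\<in>?N. (P l j - P i j) / c\<bar> \<le> (\<Sum>l\<in>?N. 3 * d1 / c)"
    using rows c by (intro order_trans[OF sum_abs] sum_mono) (simp add: divide_right_mono)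
  also have "\<dots> = 3 * d1" using c by (simp add: c_def)
  finally have bias: "\<bar>\<Sum>l\<in>?N. (P l j - P i j) / c\<bar> \<le> 3 * d1" .
  have "1 / c * (\<Sum>l\<in>?N. A l j) - P i j = (\<Sum>l\<in>?N. A l j / c) - (\<Sum>l\<in>?N. P i j / c)"
    using c by (simp add: sum_divide_distrib[symmetric] c_def)
  also have "\<dots> = (\<Sum>l\<in>?N. (A l j - P l j) / c) + (\<Sum>l\<in>?N. (P l j - P i j) / c)"
    by (simp add: sum_subtractf sum.distrib[symmetric] diff_divide_distrib)
  finally show ?thesis using dev bias unfolding c_def by linarith
qed

text \<open>A union bound over three stars for each ordered pair. The squared weights sum to at most
  \<open>1 / n\<close> for the codegree stars and to the reciprocal of the neighborhood size for the
  averages, hence to at most \<open>1 / m\<close> in all cases.\<close>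

lemma typical_graph_likely:
  assumes P: "prob_matrix n P" and n: "3 \<le> n" and h: "0 < bandwidth C n" "bandwidth C n \<le> 1" and t: "0 < t"
  shows "measure (adjacency_pmf n P) {A. \<not> typical_graph C n t P A} \<le>
    6 * (real n)\<^sup>2 * exp (- 2 * t\<^sup>2 * (bandwidth C n * (real n - 2)))"
proof -
  define m where "m = bandwidth C n * (real n - 2)"
  have m: "0 < m" using h n by (simp add: m_def)
  have "m \<le> 1 * (real n - 2)" unfolding m_def using h n by (intro mult_right_mono) auto
  then have mn: "m \<le> real n" by simp
  let ?p = "adjacency_pmf n P"
  define D where "D = {(i, k). i < n \<and> k < n \<and> i \<noteq> k}"
  have D: "finite D" "card D \<le> n\<^sup>2"
  proof -
    have sub: "D \<subseteq> {..<n} \<times> {..<n}" by (auto simp: D_def)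
    then show "finite D" by (rule finite_subset) simp
    show "card D \<le> n\<^sup>2" using card_mono[OF _ sub] by (simp add: power2_eq_square)
  qed
  have star: "measure ?p {A. t \<le> star_deviation n P A j a} \<le> 2 * exp (- 2 * t\<^sup>2 * m)"
    if "j < n" "\<And>e. (\<Sum>l\<in>{..<n}-{j}. (a (delete_vertex j (adjacency_matrix e)) l)\<^sup>2) \<le> 1 / m" for j a
    using prob_star_deviation[of j n P a "1 / m" t] P that m t
    by (simp add: star_deviation_def prob_matrix_def)
  have flat: "(\<Sum>l\<in>{..<n}-{j}. (w l / real n)\<^sup>2) \<le> 1 / m"
    if j: "j < n" and w: "\<And>l. l < n \<Longrightarrow> 0 \<le> w l \<and> w l \<le> 1" for j and w :: "nat \<Rightarrow> real"
  proof -
    have "(\<Sum>l\<in>{..<n}-{j}. (w l / real n)\<^sup>2) \<le> (\<Sum>l\<in>{..<n}-{j}. (1 / real n)\<^sup>2)"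
      using w by (intro sum_mono power_mono divide_right_mono) auto
    also have "\<dots> \<le> (\<Sum>l<n. (1 / real n)\<^sup>2)"
      by (intro sum_mono2) auto
    also have "\<dots> = 1 / real n" by (simp add: power2_eq_square)
    also have "\<dots> \<le> 1 / m" using m mn by (simp add: frac_le)
    finally show ?thesis .
  qed
  have w3: "(\<Sum>l\<in>{..<n}-{j}. (nbhd_weight C n i j (delete_vertex j A) l)\<^sup>2) \<le> 1 / m"
    if ij: "i < n" "j < n" "i \<noteq> j" for i j A
  proof -
    let ?N = "nbhd C n A i j"
    have "(\<Sum>l\<in>{..<n}-{j}. (nbhd_weight C n i j (delete_vertex j A) l)\<^sup>2) =
        (\<Sum>l\<in>?N. (1 / real (card ?N))\<^sup>2)"
      unfolding nbhd_weight_def nbhd_delete_vertex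
      using nbhd_subset[of C n A i j] by (intro sum.mono_neutral_cong_right) auto
    also have "\<dots> = 1 / real (card ?N)" by (simp add: power2_eq_square)
    also have "\<dots> \<le> 1 / m"
      using card_nbhd_ge[OF n ij h, of A] m by (simp add: frac_le m_def)
    finally show ?thesis .
  qed
  let ?S1 = "\<lambda>(i, k). {A. t \<le> star_deviation n P A k (\<lambda>M l. M i l / real n)}"
  let ?S2 = "\<lambda>(i, k). {A. t \<le> star_deviation n P A i (\<lambda>M l. P l k / real n)}"
  let ?S3 = "\<lambda>(i, k). {A. t \<le> star_deviation n P A k (nbhd_weight C n i k)}"
  have S: "measure ?p (?S1 z) \<le> 2 * exp (- 2 * t\<^sup>2 * m)" "measure ?p (?S2 z) \<le> 2 * exp (- 2 * t\<^sup>2 * m)"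
    "measure ?p (?S3 z) \<le> 2 * exp (- 2 * t\<^sup>2 * m)" if zD: "z \<in> D" for z
  proof -
    obtain i k where z: "z = (i, k)" "i < n" "k < n" "i \<noteq> k" using zD by (auto simp: D_def)
    show "measure ?p (?S1 z) \<le> 2 * exp (- 2 * t\<^sup>2 * m)"
      unfolding z prod.case using z
      by (intro star flat) (auto simp: delete_vertex_def adjacency_matrix_def)
    show "measure ?p (?S2 z) \<le> 2 * exp (- 2 * t\<^sup>2 * m)"
      unfolding z prod.case using z prob_matrix_bounds[OF P] by (intro star flat) auto
    show "measure ?p (?S3 z) \<le> 2 * exp (- 2 * t\<^sup>2 * m)"
      unfolding z prod.case using z by (intro star w3) auto
  qed
  have "measure ?p {A. \<not> typical_graph C n t P A} \<le> measure ?p (\<Union>z\<in>D. ?S1 z \<union> ?S2 z \<union> ?S3 z)"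
    by (intro measure_pmf.finite_measure_mono) (force simp: typical_graph_def D_def not_less)+
  also have "\<dots> \<le> (\<Sum>z\<in>D. measure ?p (?S1 z \<union> ?S2 z \<union> ?S3 z))"
    using D by (intro measure_pmf.finite_measure_subadditive_finite) auto
  also have "\<dots> \<le> (\<Sum>z\<in>D. 6 * exp (- 2 * t\<^sup>2 * m))"
  proof (rule sum_mono)
    fix z assume z: "z \<in> D"
    have "measure ?p (?S1 z \<union> ?S2 z \<union> ?S3 z) \<le> measure ?p (?S1 z \<union> ?S2 z) + measure ?p (?S3 z)"
      by (rule measure_Un_le) auto
    moreover have "measure ?p (?S1 z \<union> ?S2 z) \<le> measure ?p (?S1 z) + measure ?p (?S2 z)"
      by (rule measure_Un_le) auto
    ultimately show "measure ?p (?S1 z \<union> ?S2 z \<union> ?S3 z) \<le> 6 * exp (- 2 * t\<^sup>2 * m)"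
      using S[OF z] by linarith
  qed
  also have "\<dots> \<le> 6 * (real n)\<^sup>2 * exp (- 2 * t\<^sup>2 * m)"
  proof -
    have "real (card D) \<le> (real n)\<^sup>2" using D(2) by (metis of_nat_mono of_nat_power)
    then show ?thesis by simp
  qed
  finally show ?thesis by (simp add: m_def)
qed

text \<open>By symmetry of \<open>A\<close>, the second half of the estimator is the first with
  \<open>i\<close> and \<open>j\<close> exchanged, so on typical graphs both halves obey the same
  bound.\<close>

lemma smoothing_estimator_deviation:
  assumes P: "prob_matrix n P"
    and tw1: "has_twins n d1 b1 P" and tw2: "has_twins n t b2 P"
    and b: "0 < b1" "3 < b2 * real n" "bandwidth C n * (real n - 2) \<le> b2 * real n - 2"
    and h: "0 < bandwidth C n" "bandwidth C n \<le> 1"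
    and n: "4 \<le> n" "1 / real n \<le> t" and d1: "0 \<le> d1" "46 * t \<le> b1 * d1\<^sup>2"
    and \<epsilon>: "3 * d1 + t \<le> \<epsilon>" and t: "0 < t"
  shows "measure (adjacency_pmf n P) {A. offdiag_max_dist n P (smoothing_estimator C n A) > \<epsilon>} \<le>
    6 * (real n)\<^sup>2 * exp (- 2 * t\<^sup>2 * (bandwidth C n * (real n - 2)))"
proof -
  have good: "offdiag_max_dist n P (smoothing_estimator C n A) \<le> \<epsilon>"
    if A: "A = adjacency_matrix e" and typical: "typical_graph C n t P A" for A e
  proof -
    have A0: "prob_matrix n A" "\<And>i. A i i = 0"
      unfolding A by (rule prob_matrix_adjacency_matrix) (simp add: adjacency_matrix_def)
    note avg = nbhd_average_close[OF P A0 tw1 tw2 b h n d1 typical]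
    have close: "\<bar>P i j - smoothing_estimator C n A i j\<bar> \<le> \<epsilon>" if ij: "i < n" "j < n" "i \<noteq> j" for i j
    proof -
      define u where "u i j = 1 / real (card (nbhd C n A i j)) * (\<Sum>i'\<in>nbhd C n A i j. A i' j)" for i j
      have "(\<Sum>j'\<in>nbhd C n A j i. A i j') = (\<Sum>j'\<in>nbhd C n A j i. A j' i)"
        unfolding A by (intro sum.cong refl adjacency_matrix_sym)
      then have "smoothing_estimator C n A i j = 1 / 2 * (u i j + u j i)"
        by (simp add: smoothing_estimator_def u_def)
      moreover have "\<bar>P i j - u i j\<bar> \<le> 3 * d1 + t" "\<bar>P j i - u j i\<bar> \<le> 3 * d1 + t"
        unfolding u_def using avg[OF ij] avg[OF ij(2,1) not_sym[OF ij(3)]] by simp_all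
      ultimately show ?thesis
        using \<epsilon> prob_matrix_sym[OF P ij(1,2)] unfolding abs_le_iff by simp
    qed
    let ?X = "{\<bar>P i j - smoothing_estimator C n A i j\<bar> | i j. i < n \<and> j < n \<and> i \<noteq> j}"
    have "?X \<subseteq> (\<lambda>(i, j). \<bar>P i j - smoothing_estimator C n A i j\<bar>) ` ({..<n} \<times> {..<n})"
      by auto
    then have "finite ?X" by (rule finite_subset) simp
    moreover have "\<bar>P 0 1 - smoothing_estimator C n A 0 1\<bar> \<in> ?X"
      using n by (intro CollectI exI[of _ 0] exI[of _ 1]) auto
    ultimately show ?thesis
      unfolding offdiag_max_dist_def using close by (subst Max_le_iff) auto
  qed
  \<comment> \<open>Intersecting with the support leaves only matrices of the form
    \<open>adjacency_matrix e\<close>, which are symmetric with zero diagonal.\<close>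
  have "measure (adjacency_pmf n P) {A. offdiag_max_dist n P (smoothing_estimator C n A) > \<epsilon>} =
      measure (adjacency_pmf n P) ({A. offdiag_max_dist n P (smoothing_estimator C n A) > \<epsilon>} \<inter> set_pmf (adjacency_pmf n P))"
    by (simp add: measure_Int_set_pmf)
  also have "\<dots> \<le> measure (adjacency_pmf n P) {A. \<not> typical_graph C n t P A}"
    using good by (intro measure_pmf.finite_measure_mono) (force simp: adjacency_pmf_def not_less[symmetric])+
  also have "\<dots> \<le> 6 * (real n)\<^sup>2 * exp (- 2 * t\<^sup>2 * (bandwidth C n * (real n - 2)))"
    using n by (intro typical_graph_likely P h t) auto
  finally show ?thesis .
qed

section \<open>Averaging over the sample points\<close>

text \<open>The conditional probability of \<open>S\<close> given \<open>x\<close> is integrated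
  over \<open>x\<close>, using the bound \<open>\<delta>\<close> on \<open>G\<close> and 1
  elsewhere.\<close>

lemma measure_sample_law_le:
  assumes W: "graphon W" and S: "S \<in> sets (sample_law W n)"
    and G: "G \<in> sets (latent_law n)" and \<delta>: "0 \<le> \<delta>"
    and le: "\<And>x. x \<in> G \<Longrightarrow> measure (adjacency_pmf n (edge_prob W x)) {A. (x, A) \<in> S} \<le> \<delta>"
  shows "measure (sample_law W n) S \<le> measure (latent_law n) (space (latent_law n) - G) + \<delta>"
proof -
  interpret L: prob_space "latent_law n" by (rule prob_space_latent_law)
  interpret Sm: prob_space "sample_law W n" by (rule prob_space_sample_law[OF W])
  let ?N = "latent_law n \<Otimes>\<^sub>M (count_space UNIV :: (nat \<Rightarrow> nat \<Rightarrow> real) measure)"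
  let ?K = "\<lambda>x. distr (measure_pmf (adjacency_pmf n (edge_prob W x))) ?N (\<lambda>A. (x, A))"
  have SN: "S \<in> sets ?N" using S by (simp add: sets_sample_law[OF W])
  have L_alg: "latent_law n \<in> space (prob_algebra (latent_law n))"
    by (simp add: space_prob_algebra prob_space_latent_law)
  have K: "emeasure (?K x) S = ennreal (measure (adjacency_pmf n (edge_prob W x)) {A. (x, A) \<in> S})"
    if "x \<in> space (latent_law n)" for x
    using SN that
    by (subst emeasure_distr) (auto simp: space_pair_measure vimage_def measure_pmf.emeasure_eq_measure)
  have "emeasure (sample_law W n) S = (\<integral>\<^sup>+x. emeasure (?K x) S \<partial>latent_law n)"
    unfolding sample_law_def
    by (rule emeasure_bind_prob_algebra[OF L_alg adjacency_kernel_measurable[OF W] SN])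
  also have "\<dots> \<le> (\<integral>\<^sup>+x. indicator (space (latent_law n) - G) x + ennreal \<delta> \<partial>latent_law n)"
  proof (rule nn_integral_mono)
    fix x assume x: "x \<in> space (latent_law n)"
    show "emeasure (?K x) S \<le> indicator (space (latent_law n) - G) x + ennreal \<delta>"
    proof (cases "x \<in> G")
      case True
      then show ?thesis using le[OF True] by (simp add: K[OF x] ennreal_leI)
    next
      case False
      have "emeasure (?K x) S \<le> 1" by (simp add: K[OF x])
      also have "1 \<le> 1 + ennreal \<delta>" by simp
      finally show ?thesis using False x by simp
    qed
  qed
  also have "\<dots> = emeasure (latent_law n) (space (latent_law n) - G) + ennreal \<delta>"
    using G by (subst nn_integral_add) (auto simp: L.emeasure_space_1)
  also have "\<dots> = ennreal (measure (latent_law n) (space (latent_law n) - G) + \<delta>)"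
    using \<delta> by (simp add: L.emeasure_eq_measure)
  finally show ?thesis
    using \<delta> unfolding Sm.emeasure_eq_measure by (subst (asm) ennreal_le_iff) auto
qed

theorem theorem2:
  fixes W :: "real \<Rightarrow> real \<Rightarrow> real" and C :: real
  assumes "graphon W"
    and "piecewise_lipschitz W"
    and "0 < C" and "C < 1"
  shows "\<forall>\<epsilon>>0. (\<lambda>n. measure (sample_law W n)
            {(x, A) \<in> space (sample_law W n).
               offdiag_max_dist n (edge_prob W x) (smoothing_estimator C n A) > \<epsilon>})
          \<longlonglongrightarrow> 0"
proof (intro allI impI)
  fix \<epsilon> :: real assume \<epsilon>: "0 < \<epsilon>"
  \<comment> \<open>The bias \<open>3 * d\<close> takes half of \<open>\<epsilon>\<close>, and
    \<open>t\<close> at most the other half. The choices are made in the order \<open>d\<close>,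
    \<open>b1\<close>, \<open>t\<close>, \<open>b2\<close>, all before \<open>n\<close>
    grows.\<close>
  define d where "d = \<epsilon> / 6"
  have d: "0 < d" using \<epsilon> by (simp add: d_def)
  obtain b1 G1 where b1: "0 < b1" and G1: "\<And>n. G1 n \<in> sets (latent_law n)"
      "\<And>n x. x \<in> G1 n \<Longrightarrow> has_twins n d b1 (edge_prob W x)"
      "(\<lambda>n. measure (latent_law n) (space (latent_law n) - G1 n)) \<longlonglongrightarrow> 0"
    by (rule has_twins_likely[OF assms(2) d]) (rule that)
  define t where "t = min (\<epsilon> / 2) (b1 * d\<^sup>2 / 46)"
  have t: "0 < t" "46 * t \<le> b1 * d\<^sup>2" "3 * d + t \<le> \<epsilon>"
    using \<epsilon> b1 d by (auto simp: t_def d_def min_def)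
  obtain b2 G2 where b2: "0 < b2" and G2: "\<And>n. G2 n \<in> sets (latent_law n)"
      "\<And>n x. x \<in> G2 n \<Longrightarrow> has_twins n t b2 (edge_prob W x)"
      "(\<lambda>n. measure (latent_law n) (space (latent_law n) - G2 n)) \<longlonglongrightarrow> 0"
    by (rule has_twins_likely[OF assms(2) t(1)]) (rule that)
  let ?\<delta> = "\<lambda>n. 6 * (real n)\<^sup>2 * exp (- 2 * t\<^sup>2 * (bandwidth C n * (real n - 2)))"
  let ?L = "\<lambda>n. measure (latent_law n)"
  let ?u = "\<lambda>n. ?L n (space (latent_law n) - G1 n) + ?L n (space (latent_law n) - G2 n) + ?\<delta> n"
  \<comment> \<open>The bandwidth tends to 0, so it eventually falls below the fixed proportion
    \<open>b2\<close>, with room for the two discarded vertices.\<close>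
  have large: "\<forall>\<^sub>F n in sequentially. 3 < b2 * real n"
      "\<forall>\<^sub>F n in sequentially. bandwidth C n * (real n - 2) \<le> b2 * real n - 2"
      "\<forall>\<^sub>F n in sequentially. 0 < bandwidth C n" "\<forall>\<^sub>F n in sequentially. bandwidth C n \<le> 1"
      "\<forall>\<^sub>F n in sequentially. 1 / real n \<le> t"
    unfolding bandwidth_def using b2 t(1) \<open>0 < C\<close> by real_asymp+
  \<comment> \<open>\<open>n * bandwidth C n\<close> is of order \<open>sqrt (n * ln n)\<close>, so
    the exponential outweighs the factor \<open>n\<^sup>2\<close> from the union bound.\<close>
  have "?\<delta> \<longlonglongrightarrow> 0"
    unfolding bandwidth_def using t(1) \<open>0 < C\<close> by real_asymp
  then have lim: "?u \<longlonglongrightarrow> 0"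
    using tendsto_add[OF tendsto_add[OF G1(3) G2(3)]] by force
  let ?B = "\<lambda>n. {(x, A) \<in> space (sample_law W n).
      offdiag_max_dist n (edge_prob W x) (smoothing_estimator C n A) > \<epsilon>}"
  have "\<forall>\<^sub>F n in sequentially. measure (sample_law W n) (?B n) \<le> ?u n"
    using large eventually_ge_at_top[of 4]
  proof eventually_elim
    case (elim n)
    interpret L: prob_space "latent_law n" by (rule prob_space_latent_law)
    have G: "G1 n \<inter> G2 n \<in> sets (latent_law n)" using G1(1) G2(1) by blast
    have "measure (sample_law W n) (?B n) \<le>
        ?L n (space (latent_law n) - (G1 n \<inter> G2 n)) + ?\<delta> n"
    proof (rule measure_sample_law_le[OF assms(1) deviation_event_measurable[OF assms(1)] G])
      fix x assume x: "x \<in> G1 n \<inter> G2 n"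
      have sp: "x \<in> space (latent_law n)" using x sets.sets_into_space[OF G1(1)] by blast
      have "measure (adjacency_pmf n (edge_prob W x)) {A. (x, A) \<in> ?B n} \<le>
          measure (adjacency_pmf n (edge_prob W x))
            {A. offdiag_max_dist n (edge_prob W x) (smoothing_estimator C n A) > \<epsilon>}"
        by (intro measure_pmf.finite_measure_mono) auto
      also have "\<dots> \<le> ?\<delta> n"
        using x elim b1 d t G1(2) G2(2)
        by (intro smoothing_estimator_deviation[where ?d1.0 = d and ?b1.0 = b1 and ?b2.0 = b2]
            prob_matrix_edge_prob assms(1) sp) auto
      finally show "measure (adjacency_pmf n (edge_prob W x)) {A. (x, A) \<in> ?B n} \<le> ?\<delta> n" .
    qed simp
    moreover have "?L n (space (latent_law n) - (G1 n \<inter> G2 n)) \<le>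
        ?L n (space (latent_law n) - G1 n) + ?L n (space (latent_law n) - G2 n)"
      unfolding Diff_Int using G1(1) G2(1) by (intro measure_Un_le) auto
    ultimately show ?case by simp
  qed
  then show "(\<lambda>n. measure (sample_law W n) (?B n)) \<longlonglongrightarrow> 0"
    by (intro tendsto_sandwich[OF _ _ tendsto_const lim]) (simp_all add: measure_nonneg)
qed

end
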